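(* Let $(\mathfrak{A}_1,\theta_1)$ and $(\mathfrak{A}_2,\theta_2)$ be unital $\mathbb{Z}_2$-graded $C^*$-algebras and let $\omega_i$ be an even state on $\mathfrak{A}_i$, $i=1,2$. Then, up to unitary equivalence, $\pi_{\omega_1\times\omega_2}=\pi_{\omega_1}\otimes_F\pi_{\omega_2}$ as representations of the Fermi tensor product $\mathfrak{A}_1\otimes_F\mathfrak{A}_2$.
   Context: A $\mathbb{Z}_2$-graded $C^*$-algebra is a pair $(\mathfrak{A},\theta)$ with $\mathfrak{A}$ a $C^*$-algebra and $\theta$ a $*$-automorphism of $\mathfrak{A}$ with $\theta^2=\mathrm{id}$. Set $\mathfrak{A}_\pm=\{a:\theta(a)=\pm a\}$; elements of $\mathfrak{A}_+\cup\mathfrak{A}_-$ are homogeneous, with grade $\partial(a)=\pm1$ for $a\in\mathfrak{A}_\pm$. A $\mathbb{Z}_2$-graded Hilbert space is a pair $(\mathcal{H},U)$ with $U$ a self-adjoint unitary on $\mathcal{H}$; homogeneous vectors are those in $\mathcal{H}_\pm=\ker(I\mp U)$, with grade $\pm1$; $\mathcal{B}(\mathcal{H})$ is graded by $\mathrm{ad}_U(T)=UTU^*$. For homogeneous objects $x,y$ (algebra elements, operators or vectors) put $\varepsilon(x,y)=-1$ if both have grade $-1$ and $\varepsilon(x,y)=1$ otherwise. The Fermi tensor product $\mathfrak{A}_1\otimes_F\mathfrak{A}_2$ is the algebraic tensor product $\mathfrak{A}_1\odot\mathfrak{A}_2$ with product and involution determined on homogeneous elements by $(a_1\otimes a_2)(b_1\otimes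 b_2)=\varepsilon(a_2,b_1)\,a_1b_1\otimes a_2b_2$ and $(a_1\otimes a_2)^*=\varepsilon(a_1,a_2)\,a_1^*\otimes a_2^*$. A state $\omega$ on $\mathfrak{A}$ is even if $\omega\circ\theta=\omega$. Its GNS triple $(\mathcal{H}_\omega,\pi_\omega,\xi_\omega)$ then carries the self-adjoint unitary $V_{\theta,\omega}$ determined by $V_{\theta,\omega}\pi_\omega(a)\xi_\omega=\pi_\omega(\theta(a))\xi_\omega$, and $(\mathcal{H}_\omega,V_{\theta,\omega})$ is a graded Hilbert space with $\pi_\omega\circ\theta=\mathrm{ad}_{V_{\theta,\omega}}\circ\pi_\omega$. For even $\omega_1,\omega_2$ the functional $(\omega_1\times\omega_2)(a_1\otimes a_2)=\omega_1(a_1)\omega_2(a_2)$ is a state on $\mathfrak{A}_1\otimes_F\mathfrak{A}_2$, with GNS representation $\pi_{\omega_1\times\omega_2}$. For graded Hilbert spaces $(\mathcal{H}_i,U_i)$, $T_1\in\mathcal{B}(\mathcal{H}_1)$ and homogeneous $T_2\in\mathcal{B}(\mathcal{H}_2)$, $T_1\otimes_F T_2$ is the bounded operator on $\mathcal{H}_1\otimes\mathcal{H}_2$ with $(T_1\otimes_F T_2)(\xi\otimes\eta)=\varepsilon(T_2,\xi)\,T_1\xi\otimes T_2\eta$ for homogeneous $\xi\in\mathcal{H}_1$ and any $\eta\in\mathcal{H}_2$; this is extended linearly to all $T_2$. Then $\pi_{\omega_1}\otimes_F\pi_{\omega_2}$ is the representation of $\mathfrak{A}_1\otimes_F\mathfrak{A}_2$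 on $\mathcal{H}_{\omega_1}\otimes\mathcal{H}_{\omega_2}$ given by $a_1\otimes a_2\mapsto\pi_{\omega_1}(a_1)\otimes_F\pi_{\omega_2}(a_2)$. *)

theory Defs
  imports "HOL-Analysis.Analysis" "HOL-Library.Poly_Mapping"
begin

section \<open>Complex vector spaces and Hilbert spaces\<close>

class complex_vector = real_vector +
  fixes scaleC :: "complex \<Rightarrow> 'a \<Rightarrow> 'a"  (infixr \<open>*\<^sub>C\<close> 75)
  assumes scaleC_add_right: "c *\<^sub>C (x + y) = c *\<^sub>C x + c *\<^sub>C y"
    and scaleC_add_left: "(c + d) *\<^sub>C x = c *\<^sub>C x + d *\<^sub>C x"
    and scaleC_scaleC: "c *\<^sub>C d *\<^sub>C x = (c * d) *\<^sub>C x"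
    and scaleC_one: "1 *\<^sub>C x = x"
    and scaleR_scaleC: "r *\<^sub>R x = complex_of_real r *\<^sub>C x"

global_interpretation complex_vector: vector_space "scaleC :: complex \<Rightarrow> 'a \<Rightarrow> 'a::complex_vector"
  defines cspan = complex_vector.span
  by unfold_locales (simp_all add: scaleC_add_right scaleC_add_left scaleC_scaleC scaleC_one)

instantiation complex :: complex_vector
begin
definition "scaleC_complex = ((*) :: complex \<Rightarrow> complex \<Rightarrow> complex)"
instance
  by standard (simp_all add: scaleC_complex_def algebra_simps scaleR_conv_of_real)
end

text \<open>The inner product is conjugate-linear in the first and linear in the second variable.\<close>

class chilbert_space = complex_vector + banach +
  fixes cinner :: "'a \<Rightarrow> 'a \<Rightarrow> complex"
  assumes cinner_commute: "cinner x y = cnj (cinner y x)"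
    and cinner_add_right: "cinner x (y + z) = cinner x y + cinner x z"
    and cinner_scaleC_right: "cinner x (c *\<^sub>C y) = c * cinner x y"
    and cinner_nonneg: "cinner x x \<in> \<real>\<^sub>\<ge>\<^sub>0"
    and cinner_eq_zero_iff: "cinner x x = 0 \<longleftrightarrow> x = 0"
    and norm_eq_sqrt_cinner: "norm x = sqrt (cmod (cinner x x))"

definition clinear :: "('a::complex_vector \<Rightarrow> 'b::complex_vector) \<Rightarrow> bool" where
  "clinear f \<longleftrightarrow> (\<forall>x y. f (x + y) = f x + f y) \<and> (\<forall>c x. f (c *\<^sub>C x) = c *\<^sub>C f x)"

definition antilinear :: "('a::complex_vector \<Rightarrow> 'b::complex_vector) \<Rightarrow> bool" where
  "antilinear f \<longleftrightarrow> (\<forall>x y. f (x + y) = f x + f y) \<and> (\<forall>c x. f (c *\<^sub>C x) = cnj c *\<^sub>C f x)"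

definition cbilinear ::
  "('a::complex_vector \<Rightarrow> 'b::complex_vector \<Rightarrow> 'c::complex_vector) \<Rightarrow> bool" where
  "cbilinear f \<longleftrightarrow> (\<forall>y. clinear (\<lambda>x. f x y)) \<and> (\<forall>x. clinear (f x))"

definition bounded_clinear :: "('a::chilbert_space \<Rightarrow> 'b::chilbert_space) \<Rightarrow> bool" where
  "bounded_clinear f \<longleftrightarrow> clinear f \<and> (\<exists>K. \<forall>x. norm (f x) \<le> K * norm x)"

definition unitary :: "('a::chilbert_space \<Rightarrow> 'b::chilbert_space) \<Rightarrow> bool" where
  "unitary W \<longleftrightarrow> clinear W \<and> (\<forall>x y. cinner (W x) (W y) = cinner x y) \<and> surj W"

definition self_adjoint_unitary :: "('a::chilbert_space \<Rightarrow> 'a) \<Rightarrow> bool" where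
  "self_adjoint_unitary U \<longleftrightarrow> unitary U \<and> (\<forall>x y. cinner (U x) y = cinner x (U y))"


section \<open>Algebraic tensor products\<close>

text \<open>
  A finitely supported function \<open>p\<close> on \<open>A \<times> B\<close> stands for the formal sum of the
  \<open>p (a, b) \<cdot> (a, b)\<close>. The tensor product is the quotient by the span of the relations
  expressing bilinearity; the coefficient \<open>z\<close> in the generators makes the generated
  additive group a complex subspace.
\<close>

inductive_set tensor_null ::
  "(('a::complex_vector \<times> 'b::complex_vector) \<Rightarrow>\<^sub>0 complex) set" where
  zero: "0 \<in> tensor_null"
| diff: "p \<in> tensor_null \<Longrightarrow> q \<in> tensor_null \<Longrightarrow> p - q \<in> tensor_null"
| add_left: "Poly_Mapping.single (a + a', b) z - Poly_Mapping.single (a, b) z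
    - Poly_Mapping.single (a', b) z \<in> tensor_null"
| add_right: "Poly_Mapping.single (a, b + b') z - Poly_Mapping.single (a, b) z
    - Poly_Mapping.single (a, b') z \<in> tensor_null"
| scale_left: "Poly_Mapping.single (c *\<^sub>C a, b) z - Poly_Mapping.single (a, b) (c * z) \<in> tensor_null"
| scale_right: "Poly_Mapping.single (a, c *\<^sub>C b) z - Poly_Mapping.single (a, b) (c * z) \<in> tensor_null"

lemma tensor_null_uminus: "p \<in> tensor_null \<Longrightarrow> - p \<in> tensor_null"
  using tensor_null.diff[OF tensor_null.zero, of p] by simp

lemma tensor_null_add: "p \<in> tensor_null \<Longrightarrow> q \<in> tensor_null \<Longrightarrow> p + q \<in> tensor_null"
  using tensor_null.diff[of p "- q"] tensor_null_uminus[of q] by simp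

definition fscale :: "complex \<Rightarrow> ('k \<Rightarrow>\<^sub>0 complex) \<Rightarrow> ('k \<Rightarrow>\<^sub>0 complex)" where
  "fscale c = Poly_Mapping.map ((*) c)"

lemma lookup_fscale [simp]: "Poly_Mapping.lookup (fscale c p) k = c * Poly_Mapping.lookup p k"
  by (simp add: fscale_def Poly_Mapping.map.rep_eq when_def)

lemma fscale_diff: "fscale c (p - q) = fscale c p - fscale c q"
  by (rule poly_mapping_eqI) (simp add: lookup_minus algebra_simps)

lemma fscale_add: "fscale c (p + q) = fscale c p + fscale c q"
  by (rule poly_mapping_eqI) (simp add: lookup_add algebra_simps)

lemma fscale_add_left: "fscale (c + d) p = fscale c p + fscale d p"
  by (rule poly_mapping_eqI) (simp add: lookup_add algebra_simps)

lemma fscale_fscale: "fscale c (fscale d p) = fscale (c * d) p"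
  by (rule poly_mapping_eqI) (simp add: algebra_simps)

lemma fscale_one: "fscale 1 p = p"
  by (rule poly_mapping_eqI) simp

lemma fscale_zero [simp]: "fscale c 0 = 0"
  by (rule poly_mapping_eqI) simp

lemma fscale_single [simp]: "fscale c (Poly_Mapping.single k z) = Poly_Mapping.single k (c * z)"
  by (rule poly_mapping_eqI) (simp add: lookup_single when_def)

lemma fscale_tensor_null: "p \<in> tensor_null \<Longrightarrow> fscale c p \<in> tensor_null"
proof (induction rule: tensor_null.induct)
  case (scale_left d a b z)
  show ?case
    using tensor_null.scale_left[of d a b "c * z"] by (simp add: fscale_diff mult.left_commute)
next
  case (scale_right a d b z)
  show ?case
    using tensor_null.scale_right[of a d b "c * z"] by (simp add: fscale_diff mult.left_commute)
qed (simp_all add: fscale_diff tensor_null.intros)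

quotient_type (overloaded) ('a, 'b) alg_tensor =
  "('a::complex_vector \<times> 'b::complex_vector) \<Rightarrow>\<^sub>0 complex" / "\<lambda>p q. p - q \<in> tensor_null"
proof (rule equivpI)
  show "reflp (\<lambda>p q :: ('a \<times> 'b) \<Rightarrow>\<^sub>0 complex. p - q \<in> tensor_null)"
    by (simp add: reflp_def tensor_null.zero)
  show "symp (\<lambda>p q :: ('a \<times> 'b) \<Rightarrow>\<^sub>0 complex. p - q \<in> tensor_null)"
  proof (rule sympI)
    fix p q :: "('a \<times> 'b) \<Rightarrow>\<^sub>0 complex"
    assume "p - q \<in> tensor_null"
    from tensor_null_uminus[OF this] show "q - p \<in> tensor_null" by simp
  qed
  show "transp (\<lambda>p q :: ('a \<times> 'b) \<Rightarrow>\<^sub>0 complex. p - q \<in> tensor_null)"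
  proof (rule transpI)
    fix p q r :: "('a \<times> 'b) \<Rightarrow>\<^sub>0 complex"
    assume "p - q \<in> tensor_null" "q - r \<in> tensor_null"
    from tensor_null_add[OF this] show "p - r \<in> tensor_null" by simp
  qed
qed

lift_definition tensor :: "'a::complex_vector \<Rightarrow> 'b::complex_vector \<Rightarrow> ('a, 'b) alg_tensor"
    (infixl \<open>\<otimes>\<^sub>a\<close> 70)
  is "\<lambda>a b. Poly_Mapping.single (a, b) 1" .

instantiation alg_tensor :: (complex_vector, complex_vector) complex_vector
begin

lift_definition zero_alg_tensor :: "('a, 'b) alg_tensor" is 0 .

lift_definition plus_alg_tensor ::
  "('a, 'b) alg_tensor \<Rightarrow> ('a, 'b) alg_tensor \<Rightarrow> ('a, 'b) alg_tensor" is "(+)"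
proof -
  fix p p' q q' :: "('a \<times> 'b) \<Rightarrow>\<^sub>0 complex"
  assume "p - p' \<in> tensor_null" "q - q' \<in> tensor_null"
  from tensor_null_add[OF this] show "p + q - (p' + q') \<in> tensor_null"
    by (simp add: algebra_simps)
qed

lift_definition uminus_alg_tensor :: "('a, 'b) alg_tensor \<Rightarrow> ('a, 'b) alg_tensor" is uminus
proof -
  fix p q :: "('a \<times> 'b) \<Rightarrow>\<^sub>0 complex"
  assume "p - q \<in> tensor_null"
  from tensor_null_uminus[OF this] show "- p - - q \<in> tensor_null" by simp
qed

lift_definition minus_alg_tensor ::
  "('a, 'b) alg_tensor \<Rightarrow> ('a, 'b) alg_tensor \<Rightarrow> ('a, 'b) alg_tensor" is "(-)"
proof -
  fix p p' q q' :: "('a \<times> 'b) \<Rightarrow>\<^sub>0 complex"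
  assume "p - p' \<in> tensor_null" "q - q' \<in> tensor_null"
  from tensor_null.diff[OF this] show "p - q - (p' - q') \<in> tensor_null"
    by (simp add: algebra_simps)
qed

lift_definition scaleC_alg_tensor :: "complex \<Rightarrow> ('a, 'b) alg_tensor \<Rightarrow> ('a, 'b) alg_tensor"
  is fscale
  unfolding fscale_diff[symmetric] by (rule fscale_tensor_null)

definition scaleR_alg_tensor :: "real \<Rightarrow> ('a, 'b) alg_tensor \<Rightarrow> ('a, 'b) alg_tensor" where
  "scaleR_alg_tensor r = scaleC (complex_of_real r)"

instance
proof
  fix x y z :: "('a, 'b) alg_tensor" and c d :: complex and r s :: real
  show "x + y + z = x + (y + z)" by transfer (simp add: tensor_null.zero algebra_simps)
  show "x + y = y + x" by transfer (simp add: tensor_null.zero algebra_simps)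
  show "0 + x = x" by transfer (simp add: tensor_null.zero)
  show "- x + x = 0" by transfer (simp add: tensor_null.zero)
  show "x - y = x + - y" by transfer (simp add: tensor_null.zero)
  show A: "c *\<^sub>C (x + y) = c *\<^sub>C x + c *\<^sub>C y" for c and x y :: "('a, 'b) alg_tensor"
    by transfer (simp add: tensor_null.zero fscale_add)
  show B: "(c + d) *\<^sub>C x = c *\<^sub>C x + d *\<^sub>C x" for c d and x :: "('a, 'b) alg_tensor"
    by transfer (simp add: tensor_null.zero fscale_add_left)
  show C: "c *\<^sub>C d *\<^sub>C x = (c * d) *\<^sub>C x" for c d and x :: "('a, 'b) alg_tensor"
    by transfer (simp add: tensor_null.zero fscale_fscale)
  show D: "1 *\<^sub>C x = x" for x :: "('a, 'b) alg_tensor"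
    by transfer (simp add: tensor_null.zero fscale_one)
  show "r *\<^sub>R x = complex_of_real r *\<^sub>C x" by (simp add: scaleR_alg_tensor_def)
  show "r *\<^sub>R (x + y) = r *\<^sub>R x + r *\<^sub>R y"
    unfolding scaleR_alg_tensor_def by (rule A)
  show "(r + s) *\<^sub>R x = r *\<^sub>R x + s *\<^sub>R x"
    unfolding scaleR_alg_tensor_def of_real_add by (rule B)
  show "r *\<^sub>R s *\<^sub>R x = (r * s) *\<^sub>R x"
    unfolding scaleR_alg_tensor_def of_real_mult by (rule C)
  show "1 *\<^sub>R x = x"
    unfolding scaleR_alg_tensor_def of_real_1 by (rule D)
qed

end

lemma cbilinear_tensor: "cbilinear (\<otimes>\<^sub>a)"
  unfolding cbilinear_def clinear_def
proof (intro conjI allI)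
  fix a a' :: 'a and b b' :: 'b and c :: complex
  show "(a + a') \<otimes>\<^sub>a b = a \<otimes>\<^sub>a b + a' \<otimes>\<^sub>a b"
    by transfer (use tensor_null.add_left in \<open>simp add: algebra_simps\<close>)
  show "a \<otimes>\<^sub>a (b + b') = a \<otimes>\<^sub>a b + a \<otimes>\<^sub>a b'"
    by transfer (use tensor_null.add_right in \<open>simp add: algebra_simps\<close>)
  show "(c *\<^sub>C a) \<otimes>\<^sub>a b = c *\<^sub>C (a \<otimes>\<^sub>a b)"
    using tensor_null.scale_left[of c a b 1]
    by (simp add: tensor.abs_eq scaleC_alg_tensor.abs_eq alg_tensor.abs_eq_iff)
  show "a \<otimes>\<^sub>a (c *\<^sub>C b) = c *\<^sub>C (a \<otimes>\<^sub>a b)"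
    using tensor_null.scale_right[of a c b 1]
    by (simp add: tensor.abs_eq scaleC_alg_tensor.abs_eq alg_tensor.abs_eq_iff)
qed

lemma tensor_simps:
  "(a + a') \<otimes>\<^sub>a b = a \<otimes>\<^sub>a b + a' \<otimes>\<^sub>a b"
  "a \<otimes>\<^sub>a (b + b') = a \<otimes>\<^sub>a b + a \<otimes>\<^sub>a b'"
  "(c *\<^sub>C a) \<otimes>\<^sub>a b = c *\<^sub>C (a \<otimes>\<^sub>a b)"
  "a \<otimes>\<^sub>a (c *\<^sub>C b) = c *\<^sub>C (a \<otimes>\<^sub>a b)"
  using cbilinear_tensor[where 'a='a and 'b='b] unfolding cbilinear_def clinear_def by blast+

lemma alg_tensor_induct [case_names zero add tensor]:
  assumes "P 0" "\<And>x y. P x \<Longrightarrow> P y \<Longrightarrow> P (x + y)" "\<And>a b. P (a \<otimes>\<^sub>a b)"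
  shows "P (x :: ('a::complex_vector, 'b::complex_vector) alg_tensor)"
proof -
  have single: "abs_alg_tensor (Poly_Mapping.single k z) = (z *\<^sub>C fst k) \<otimes>\<^sub>a snd k"
    for k :: "'a \<times> 'b" and z
    using tensor_null.scale_left[of z "fst k" "snd k" 1, THEN tensor_null_uminus]
    unfolding tensor.abs_eq alg_tensor.abs_eq_iff by simp
  have "P (abs_alg_tensor p)" for p
  proof (induction p rule: update_induct)
    case const
    then show ?case using assms(1) by (simp add: zero_alg_tensor_def)
  next
    case (update f a b)
    have "Poly_Mapping.update a b f = f + Poly_Mapping.single a b"
      using update.hyps
      by (intro poly_mapping_eqI) (auto simp: lookup_update lookup_add lookup_single when_def in_keys_iff)
    then show ?case
      using update.IH assms(2,3) single by (metis plus_alg_tensor.abs_eq)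
  qed
  from this[of "rep_alg_tensor x"] show ?thesis
    by (simp add: Quotient3_abs_rep[OF Quotient3_alg_tensor])
qed

text \<open>Universal property, for maps that are semilinear along \<open>\<sigma> = id\<close> or \<open>\<sigma> = cnj\<close>.\<close>

lemma alg_tensor_universal:
  fixes f :: "'a::complex_vector \<Rightarrow> 'b::complex_vector \<Rightarrow> 'c::complex_vector"
  assumes \<sigma>: "\<And>z w. \<sigma> (z + w) = \<sigma> z + \<sigma> w" "\<And>z w. \<sigma> (z * w) = \<sigma> z * \<sigma> w" "\<sigma> 1 = (1::complex)"
    and f: "\<And>a a' b. f (a + a') b = f a b + f a' b" "\<And>a b b'. f a (b + b') = f a b + f a b'"
      "\<And>c a b. f (c *\<^sub>C a) b = \<sigma> c *\<^sub>C f a b" "\<And>c a b. f a (c *\<^sub>C b) = \<sigma> c *\<^sub>C f a b"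
  shows "\<exists>!L. (\<forall>x y. L (x + y) = L x + L y) \<and> (\<forall>c x. L (c *\<^sub>C x) = \<sigma> c *\<^sub>C L x)
    \<and> (\<forall>a b. L (a \<otimes>\<^sub>a b) = f a b)"
proof -
  have \<sigma>0 [simp]: "\<sigma> 0 = 0" using \<sigma>(1)[of 0 0] by simp
  define e where "e p = (\<Sum>k\<in>Poly_Mapping.keys p. \<sigma> (Poly_Mapping.lookup p k) *\<^sub>C f (fst k) (snd k))"
    for p :: "('a \<times> 'b) \<Rightarrow>\<^sub>0 complex"
  have e_add: "e (p + q) = e p + e q" for p q
    unfolding e_def
    by (rule setsum_keys_plus_distrib) (simp_all add: \<sigma> scaleC_add_left)
  have e_single: "e (Poly_Mapping.single (a, b) z) = \<sigma> z *\<^sub>C f a b" for a b z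
    by (simp add: e_def)
  have e_scale: "e (fscale c p) = \<sigma> c *\<^sub>C e p" for c p
  proof -
    have "e (fscale c p) = (\<Sum>k\<in>Poly_Mapping.keys p.
        \<sigma> (Poly_Mapping.lookup (fscale c p) k) *\<^sub>C f (fst k) (snd k))"
      unfolding e_def
      by (rule sum.mono_neutral_left) (auto simp: in_keys_iff)
    also have "\<dots> = \<sigma> c *\<^sub>C e p"
      by (simp add: e_def \<sigma> complex_vector.scale_sum_right)
    finally show ?thesis .
  qed
  have e_diff: "e (p - q) = e p - e q" for p q
    using e_add[of "p - q" q] by simp
  have e_null: "e p = 0" if "p \<in> tensor_null" for p
    using that
    by (induction rule: tensor_null.induct)
      (simp_all add: e_diff e_single f \<sigma> scaleC_add_right mult.commute, simp add: e_def)
  have e_cong: "e p = e q" if "p - q \<in> tensor_null" for p q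
    using e_null[OF that] by (simp add: e_diff)
  define L where "L x = e (rep_alg_tensor x)" for x
  have L_abs: "L (abs_alg_tensor p) = e p" for p
    unfolding L_def
    by (intro e_cong alg_tensor.abs_eq_iff[THEN iffD1] Quotient3_abs_rep[OF Quotient3_alg_tensor])
  have L: "L (x + y) = L x + L y" "L (c *\<^sub>C x) = \<sigma> c *\<^sub>C L x" "L (a \<otimes>\<^sub>a b) = f a b" for x y c a b
  proof -
    obtain p q where "x = abs_alg_tensor p" "y = abs_alg_tensor q"
      using Quotient3_abs_rep[OF Quotient3_alg_tensor, symmetric] by blast
    then show "L (x + y) = L x + L y" "L (c *\<^sub>C x) = \<sigma> c *\<^sub>C L x"
      by (simp_all add: plus_alg_tensor.abs_eq scaleC_alg_tensor.abs_eq L_abs e_add e_scale)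
    show "L (a \<otimes>\<^sub>a b) = f a b" by (simp add: tensor.abs_eq L_abs e_single \<sigma>)
  qed
  show ?thesis
  proof (rule ex1I[of _ L])
    fix M assume M: "(\<forall>x y. M (x + y) = M x + M y) \<and> (\<forall>c x. M (c *\<^sub>C x) = \<sigma> c *\<^sub>C M x)
      \<and> (\<forall>a b. M (a \<otimes>\<^sub>a b) = f a b)"
    then have "M 0 = 0" "L 0 = 0" using L(1)[of 0 0] by (metis add_cancel_right_right)+
    then show "M = L"
      using M L by (intro ext) (rule alg_tensor_induct, auto)
  qed (use L in auto)
qed

definition tensor_lift ::
  "('a::complex_vector \<Rightarrow> 'b::complex_vector \<Rightarrow> 'c::complex_vector) \<Rightarrow> ('a, 'b) alg_tensor \<Rightarrow> 'c" where
  "tensor_lift f = (THE L. clinear L \<and> (\<forall>a b. L (a \<otimes>\<^sub>a b) = f a b))"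

lemma ex1_tensor_lift:
  assumes "cbilinear f"
  shows "\<exists>!L. clinear L \<and> (\<forall>a b. L (a \<otimes>\<^sub>a b) = f a b)"
  using alg_tensor_universal[of id f] assms
  by (simp add: clinear_def cbilinear_def conj_assoc)

lemma
  assumes "cbilinear f"
  shows clinear_tensor_lift: "clinear (tensor_lift f)"
    and tensor_lift_tensor [simp]: "tensor_lift f (a \<otimes>\<^sub>a b) = f a b"
  using theI'[OF ex1_tensor_lift[OF assms], folded tensor_lift_def] by auto

lemma ex1_antilinear_tensor:
  assumes "\<And>b. antilinear (\<lambda>a. f a b)" "\<And>a. antilinear (f a)"
  shows "\<exists>!L. antilinear L \<and> (\<forall>a b. L (a \<otimes>\<^sub>a b) = f a b)"
  using alg_tensor_universal[of cnj f] assms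
  by (simp add: antilinear_def conj_assoc)


section \<open>Graded $C^*$-algebras\<close>

class star_algebra = complex_vector + ring + monoid_mult +
  fixes star :: "'a \<Rightarrow> 'a"
  assumes mult_scaleC_left: "(c *\<^sub>C a) * b = c *\<^sub>C (a * b)"
    and mult_scaleC_right: "a * (c *\<^sub>C b) = c *\<^sub>C (a * b)"
    and star_add: "star (a + b) = star a + star b"
    and star_scaleC: "star (c *\<^sub>C a) = cnj c *\<^sub>C star a"
    and star_mult: "star (a * b) = star b * star a"
    and star_star: "star (star a) = a"

text \<open>
  The superclass \<^class>\<open>real_normed_algebra_1\<close> contains \<open>norm 1 = 1\<close>, which only excludes the
  zero algebra; the latter has no states.
\<close>

class unital_cstar_algebra = star_algebra + real_normed_algebra_1 + banach +
  assumes norm_scaleC: "norm (c *\<^sub>C a) = cmod c * norm a"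
    and cstar_identity: "norm (star a * a) = (norm a)\<^sup>2"

class z2_graded_star_algebra = star_algebra +
  fixes grading :: "'a \<Rightarrow> 'a"
  assumes grading_add: "grading (a + b) = grading a + grading b"
    and grading_scaleC: "grading (c *\<^sub>C a) = c *\<^sub>C grading a"
    and grading_mult: "grading (a * b) = grading a * grading b"
    and grading_star: "grading (star a) = star (grading a)"
    and grading_grading: "grading (grading a) = a"

class z2_graded_cstar_algebra = unital_cstar_algebra + z2_graded_star_algebra

text \<open>
  Algebra elements are graded by \<^const>\<open>grading\<close>, vectors by a self-adjoint unitary and operators
  by its adjoint action; the grading involution is passed as an argument. Only \<open>0\<close> has both grades,
  and the value of the sign is then irrelevant.
\<close>

definition homogeneous :: "('x \<Rightarrow> 'x) \<Rightarrow> 'x::uminus \<Rightarrow> bool" where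
  "homogeneous \<alpha> x \<longleftrightarrow> \<alpha> x = x \<or> \<alpha> x = - x"

definition koszul_sign :: "('x \<Rightarrow> 'x) \<Rightarrow> ('y \<Rightarrow> 'y) \<Rightarrow> 'x::uminus \<Rightarrow> 'y::uminus \<Rightarrow> complex" where
  "koszul_sign \<alpha> \<beta> x y = (if \<alpha> x = - x \<and> \<beta> y = - y then - 1 else 1)"


section \<open>The Fermi tensor product\<close>

subsection \<open>Auxiliary facts\<close>

lemma grading_uminus: "grading (- a) = - grading a"
  and grading_diff: "grading (a - b) = grading a - grading b"
  for a b :: "'a::z2_graded_star_algebra"
proof -
  show *: "grading (- a) = - grading a" for a :: 'a
    using grading_scaleC[of "- 1" a] by (simp add: complex_vector.scale_minus_left scaleC_one)
  show "grading (a - b) = grading a - grading b"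
    using grading_add[of a "- b"] by (simp add: *)
qed

lemma grading_zero [simp]: "grading (0::'a::z2_graded_star_algebra) = 0"
  using grading_diff[of 0 "0::'a"] by simp

lemma grading_one [simp]: "grading (1::'a::z2_graded_star_algebra) = 1"
  using grading_mult[of "grading 1" "1::'a"] by (simp add: grading_grading)

lemma star_zero [simp]: "star (0::'a::star_algebra) = 0"
  using star_add[of 0 "0::'a"] by simp

lemma star_one [simp]: "star (1::'a::star_algebra) = 1"
  using star_mult[of "star 1" "1::'a"] by (simp add: star_star)

lemma tensor_zero [simp]: "0 \<otimes>\<^sub>a b = 0" "a \<otimes>\<^sub>a 0 = 0"
  using tensor_simps(1)[of 0 0 b] tensor_simps(2)[of a 0 0] by simp_all

lemma cbilinearI:
  assumes "\<And>x x' y. f (x + x') y = f x y + f x' y" "\<And>x y y'. f x (y + y') = f x y + f x y'"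
    "\<And>c x y. f (c *\<^sub>C x) y = c *\<^sub>C f x y" "\<And>c x y. f x (c *\<^sub>C y) = c *\<^sub>C f x y"
  shows "cbilinear f"
  using assms by (simp add: cbilinear_def clinear_def)

lemma cbilinearD:
  assumes "cbilinear f"
  shows "f (x + x') y = f x y + f x' y" "f x (y + y') = f x y + f x y'"
    "f (c *\<^sub>C x) y = c *\<^sub>C f x y" "f x (c *\<^sub>C y) = c *\<^sub>C f x y" "f 0 y = 0" "f x 0 = 0"
proof -
  show *: "f (x + x') y = f x y + f x' y" "f x (y + y') = f x y + f x y'"
    "f (c *\<^sub>C x) y = c *\<^sub>C f x y" "f x (c *\<^sub>C y) = c *\<^sub>C f x y" for x x' y y' c
    using assms by (simp_all add: cbilinear_def clinear_def)
  show "f 0 y = 0" "f x 0 = 0"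
    using *(1)[of 0 0 y] *(2)[of x 0 0] by simp_all
qed

lemma tensor_lift_simps:
  assumes "cbilinear f"
  shows "tensor_lift f (x + y) = tensor_lift f x + tensor_lift f y"
    "tensor_lift f (c *\<^sub>C x) = c *\<^sub>C tensor_lift f x" "tensor_lift f 0 = 0"
proof -
  show *: "tensor_lift f (x + y) = tensor_lift f x + tensor_lift f y"
    "tensor_lift f (c *\<^sub>C x) = c *\<^sub>C tensor_lift f x" for x y c
    using clinear_tensor_lift[OF assms] by (simp_all add: clinear_def)
  show "tensor_lift f 0 = 0" using *(1)[of 0 0] by simp
qed

lemma tensor_lift_add:
  assumes "cbilinear f" "cbilinear g" "cbilinear h" "\<And>a b. h a b = f a b + g a b"
  shows "tensor_lift h x = tensor_lift f x + tensor_lift g x"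
  by (induction x rule: alg_tensor_induct) (simp_all add: tensor_lift_simps assms(1-3), rule assms(4))

lemma tensor_lift_scaleC:
  assumes "cbilinear f" "cbilinear h" "\<And>a b. h a b = c *\<^sub>C f a b"
  shows "tensor_lift h x = c *\<^sub>C tensor_lift f x"
  by (induction x rule: alg_tensor_induct) (simp_all add: tensor_lift_simps assms(1,2) scaleC_add_right, rule assms(3))

lemma half_sum: "(1/2::complex) *\<^sub>C x + (1/2) *\<^sub>C x = (x::'a::complex_vector)"
  by (simp add: scaleC_add_left[symmetric] scaleC_one)

lemma homogeneous_decomp:
  fixes a :: "'a::z2_graded_star_algebra"
  obtains b c where "a = b + c" "homogeneous grading b" "homogeneous grading c"
proof
  let ?b = "(1/2::complex) *\<^sub>C (a + grading a)" and ?c = "(1/2::complex) *\<^sub>C (a - grading a)"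
  have "?b + ?c = (1/2::complex) *\<^sub>C a + (1/2) *\<^sub>C a"
    by (simp add: scaleC_add_right complex_vector.scale_right_diff_distrib)
  then show "a = ?b + ?c" by (simp add: half_sum)
  show "homogeneous grading ?b"
    by (simp add: homogeneous_def grading_scaleC grading_add grading_grading add.commute)
  have "grading ?c = - ?c"
    by (simp add: grading_scaleC grading_diff grading_grading flip: complex_vector.scale_minus_right)
  then show "homogeneous grading ?c" by (simp add: homogeneous_def)
qed

lemma alg_tensor_homogeneous_induct [case_names zero add tensor]:
  fixes x :: "('a::z2_graded_star_algebra, 'b::z2_graded_star_algebra) alg_tensor"
  assumes "P 0" "\<And>x y. P x \<Longrightarrow> P y \<Longrightarrow> P (x + y)"
    "\<And>a b. homogeneous grading a \<Longrightarrow> homogeneous grading b \<Longrightarrow> P (a \<otimes>\<^sub>a b)"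
  shows "P x"
proof (induction x rule: alg_tensor_induct)
  case (tensor a b)
  obtain a1 a2 where a: "a = a1 + a2" "homogeneous grading a1" "homogeneous grading a2"
    by (rule homogeneous_decomp)
  obtain b1 b2 where b: "b = b1 + b2" "homogeneous grading b1" "homogeneous grading b2"
    by (rule homogeneous_decomp)
  show ?case unfolding a(1) b(1) tensor_simps by (intro assms a b)
qed (use assms in auto)

definition grade_sign :: "complex \<Rightarrow> complex \<Rightarrow> complex" where
  "grade_sign s t = (if s = - 1 \<and> t = - 1 then - 1 else 1)"

definition has_grade :: "complex \<Rightarrow> 'a::z2_graded_star_algebra \<Rightarrow> bool" where
  "has_grade s a \<longleftrightarrow> (s = 1 \<or> s = - 1) \<and> grading a = s *\<^sub>C a"

lemma homogeneous_has_grade: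
  assumes "homogeneous grading a" obtains s where "has_grade s a"
  using assms unfolding homogeneous_def has_grade_def
  by (metis complex_vector.scale_minus_left scaleC_one)

lemma has_grade_homogeneous: "has_grade s a \<Longrightarrow> homogeneous grading a"
  by (auto simp: has_grade_def homogeneous_def complex_vector.scale_minus_left scaleC_one)

lemma has_grade_mult: "has_grade s a \<Longrightarrow> has_grade t b \<Longrightarrow> has_grade (s * t) (a * b)"
  by (auto simp: has_grade_def grading_mult mult_scaleC_left mult_scaleC_right scaleC_scaleC
      complex_vector.scale_minus_left scaleC_one)

lemma has_grade_star: "has_grade s a \<Longrightarrow> has_grade s (star a)"
  by (auto simp: has_grade_def grading_star star_scaleC)

lemma has_grade_one: "has_grade 1 1"
  by (simp add: has_grade_def scaleC_one)

lemma has_gradeD: "has_grade s a \<Longrightarrow> s = 1 \<or> s = - 1"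
  by (simp add: has_grade_def)

lemma eq_uminus_imp_zero: "x = - x \<Longrightarrow> x = (0::'a::complex_vector)"
  by (metis add.left_inverse half_sum complex_vector.scale_zero_right scaleC_add_right)

lemma koszul_sign_grading:
  assumes "has_grade s a" "has_grade t b" "a \<noteq> 0" "b \<noteq> 0"
  shows "koszul_sign grading grading a b = grade_sign s t"
  using assms eq_uminus_imp_zero[of a] eq_uminus_imp_zero[of b]
  by (auto simp: koszul_sign_def grade_sign_def has_grade_def
      complex_vector.scale_minus_left scaleC_one)


subsection \<open>Product and involution\<close>

definition fermi_times ::
  "('a::z2_graded_star_algebra, 'b::z2_graded_star_algebra) alg_tensor
    \<Rightarrow> ('a, 'b) alg_tensor \<Rightarrow> ('a, 'b) alg_tensor" where
  "fermi_times = (THE m. cbilinear m \<and>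
    (\<forall>a\<^sub>1 a\<^sub>2 b\<^sub>1 b\<^sub>2. homogeneous grading a\<^sub>2 \<and> homogeneous grading b\<^sub>1 \<longrightarrow>
      m (a\<^sub>1 \<otimes>\<^sub>a a\<^sub>2) (b\<^sub>1 \<otimes>\<^sub>a b\<^sub>2) =
        koszul_sign grading grading a\<^sub>2 b\<^sub>1 *\<^sub>C ((a\<^sub>1 * b\<^sub>1) \<otimes>\<^sub>a (a\<^sub>2 * b\<^sub>2))))"

definition fermi_star ::
  "('a::z2_graded_star_algebra, 'b::z2_graded_star_algebra) alg_tensor \<Rightarrow> ('a, 'b) alg_tensor" where
  "fermi_star = (THE S. antilinear S \<and>
    (\<forall>a\<^sub>1 a\<^sub>2. homogeneous grading a\<^sub>1 \<and> homogeneous grading a\<^sub>2 \<longrightarrow>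
      S (a\<^sub>1 \<otimes>\<^sub>a a\<^sub>2) = koszul_sign grading grading a\<^sub>1 a\<^sub>2 *\<^sub>C (star a\<^sub>1 \<otimes>\<^sub>a star a\<^sub>2)))"

lemma ex1_fermi_times:
  "\<exists>!m. cbilinear m \<and> (\<forall>a\<^sub>1 a\<^sub>2 b\<^sub>1 b\<^sub>2. homogeneous grading a\<^sub>2 \<and> homogeneous grading b\<^sub>1 \<longrightarrow>
      m ((a\<^sub>1::'a::z2_graded_star_algebra) \<otimes>\<^sub>a (a\<^sub>2::'b::z2_graded_star_algebra)) (b\<^sub>1 \<otimes>\<^sub>a b\<^sub>2) =
        koszul_sign grading grading a\<^sub>2 b\<^sub>1 *\<^sub>C ((a\<^sub>1 * b\<^sub>1) \<otimes>\<^sub>a (a\<^sub>2 * b\<^sub>2)))"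
proof (rule ex_ex1I)
  define h :: "'a \<Rightarrow> 'b \<Rightarrow> 'a \<Rightarrow> 'b \<Rightarrow> ('a, 'b) alg_tensor" where
    "h a\<^sub>1 a\<^sub>2 b\<^sub>1 b\<^sub>2 = (a\<^sub>1 * ((1/2::complex) *\<^sub>C (b\<^sub>1 + grading b\<^sub>1))) \<otimes>\<^sub>a (a\<^sub>2 * b\<^sub>2)
      + (a\<^sub>1 * ((1/2::complex) *\<^sub>C (b\<^sub>1 - grading b\<^sub>1))) \<otimes>\<^sub>a (grading a\<^sub>2 * b\<^sub>2)" for a\<^sub>1 a\<^sub>2 b\<^sub>1 b\<^sub>2
  note hsimps = h_def tensor_simps grading_add grading_scaleC distrib_left distrib_right
    mult_scaleC_left mult_scaleC_right scaleC_add_right scaleC_scaleC mult.commute right_diff_distrib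
    complex_vector.scale_right_diff_distrib
  have h: "h (x + x') y z w = h x y z w + h x' y z w" "h x (y + y') z w = h x y z w + h x y' z w"
    "h x y (z + z') w = h x y z w + h x y z' w" "h x y z (w + w') = h x y z w + h x y z w'"
    "h (c *\<^sub>C x) y z w = c *\<^sub>C h x y z w" "h x (c *\<^sub>C y) z w = c *\<^sub>C h x y z w"
    "h x y (c *\<^sub>C z) w = c *\<^sub>C h x y z w" "h x y z (c *\<^sub>C w) = c *\<^sub>C h x y z w"
    for x x' y y' z z' w w' c
  proof -
    have neg: "(- a) \<otimes>\<^sub>a b = - (a \<otimes>\<^sub>a b)" for a :: 'a and b :: 'b
      using tensor_simps(1)[of a "- a" b] by (simp add: eq_neg_iff_add_eq_0 add.commute)
    have diff: "(a - a') \<otimes>\<^sub>a b = a \<otimes>\<^sub>a b - a' \<otimes>\<^sub>a b" for a a' :: 'a and b :: 'b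
      using tensor_simps(1)[of a "- a'" b] by (simp add: neg)
    show "h (x + x') y z w = h x y z w + h x' y z w" "h x (y + y') z w = h x y z w + h x y' z w"
      "h x y (z + z') w = h x y z w + h x y z' w" "h x y z (w + w') = h x y z w + h x y z w'"
      "h (c *\<^sub>C x) y z w = c *\<^sub>C h x y z w" "h x (c *\<^sub>C y) z w = c *\<^sub>C h x y z w"
      "h x y (c *\<^sub>C z) w = c *\<^sub>C h x y z w" "h x y z (c *\<^sub>C w) = c *\<^sub>C h x y z w"
      by (simp_all add: hsimps diff)
  qed
  have bi: "cbilinear (h x y)" for x y
    by (intro cbilinearI h)
  have bi2: "cbilinear (\<lambda>x y. tensor_lift (h x y) t)" for t
    by (intro cbilinearI tensor_lift_add tensor_lift_scaleC bi h)
  define m where "m s t = tensor_lift (\<lambda>x y. tensor_lift (h x y) t) s" for s t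
  have "cbilinear m"
    unfolding m_def
    by (rule cbilinearI, rule tensor_lift_simps(1)[OF bi2],
        rule tensor_lift_add[OF bi2 bi2 bi2 tensor_lift_simps(1)[OF bi]],
        rule tensor_lift_simps(2)[OF bi2],
        rule tensor_lift_scaleC[OF bi2 bi2 tensor_lift_simps(2)[OF bi]])
  moreover have "m (a\<^sub>1 \<otimes>\<^sub>a a\<^sub>2) (b\<^sub>1 \<otimes>\<^sub>a b\<^sub>2) =
      koszul_sign grading grading a\<^sub>2 b\<^sub>1 *\<^sub>C ((a\<^sub>1 * b\<^sub>1) \<otimes>\<^sub>a (a\<^sub>2 * b\<^sub>2))"
    if hom: "homogeneous grading a\<^sub>2" "homogeneous grading b\<^sub>1" for a\<^sub>1 a\<^sub>2 b\<^sub>1 b\<^sub>2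
  proof -
    have neg: "a \<otimes>\<^sub>a (- b) = - (a \<otimes>\<^sub>a b)" for a :: 'a and b :: 'b
      using tensor_simps(2)[of a b "- b"] by (simp add: eq_neg_iff_add_eq_0 add.commute)
    have "m (a\<^sub>1 \<otimes>\<^sub>a a\<^sub>2) (b\<^sub>1 \<otimes>\<^sub>a b\<^sub>2) = h a\<^sub>1 a\<^sub>2 b\<^sub>1 b\<^sub>2"
      unfolding m_def tensor_lift_tensor[OF bi2] by (rule tensor_lift_tensor[OF bi])
    also have "\<dots> = koszul_sign grading grading a\<^sub>2 b\<^sub>1 *\<^sub>C ((a\<^sub>1 * b\<^sub>1) \<otimes>\<^sub>a (a\<^sub>2 * b\<^sub>2))"
    proof (cases "grading b\<^sub>1 = b\<^sub>1")
      case True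
      then have "koszul_sign grading grading a\<^sub>2 b\<^sub>1 = 1 \<or> b\<^sub>1 = 0"
        using eq_uminus_imp_zero[of b\<^sub>1] by (auto simp: koszul_sign_def)
      then show ?thesis
        using True by (auto simp: h_def scaleC_one half_sum scaleC_add_right)
    next
      case False
      then have "grading b\<^sub>1 = - b\<^sub>1" using hom by (auto simp: homogeneous_def)
      then show ?thesis
        using hom(1) eq_uminus_imp_zero[of a\<^sub>2]
        by (auto simp: h_def scaleC_one half_sum scaleC_add_right koszul_sign_def homogeneous_def
            complex_vector.scale_minus_left neg)
    qed
    finally show ?thesis .
  qed
  ultimately show "\<exists>m. cbilinear m \<and> (\<forall>a\<^sub>1 a\<^sub>2 b\<^sub>1 b\<^sub>2. homogeneous grading a\<^sub>2 \<and> homogeneous grading b\<^sub>1 \<longrightarrow>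
      m ((a\<^sub>1::'a) \<otimes>\<^sub>a (a\<^sub>2::'b)) (b\<^sub>1 \<otimes>\<^sub>a b\<^sub>2) =
        koszul_sign grading grading a\<^sub>2 b\<^sub>1 *\<^sub>C ((a\<^sub>1 * b\<^sub>1) \<otimes>\<^sub>a (a\<^sub>2 * b\<^sub>2)))"
    by blast
next
  fix m n :: "('a, 'b) alg_tensor \<Rightarrow> ('a, 'b) alg_tensor \<Rightarrow> ('a, 'b) alg_tensor"
  assume m: "cbilinear m \<and> (\<forall>a\<^sub>1 a\<^sub>2 b\<^sub>1 b\<^sub>2. homogeneous grading a\<^sub>2 \<and> homogeneous grading b\<^sub>1 \<longrightarrow>
      m (a\<^sub>1 \<otimes>\<^sub>a a\<^sub>2) (b\<^sub>1 \<otimes>\<^sub>a b\<^sub>2) =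
        koszul_sign grading grading a\<^sub>2 b\<^sub>1 *\<^sub>C ((a\<^sub>1 * b\<^sub>1) \<otimes>\<^sub>a (a\<^sub>2 * b\<^sub>2)))"
    and n: "cbilinear n \<and> (\<forall>a\<^sub>1 a\<^sub>2 b\<^sub>1 b\<^sub>2. homogeneous grading a\<^sub>2 \<and> homogeneous grading b\<^sub>1 \<longrightarrow>
      n (a\<^sub>1 \<otimes>\<^sub>a a\<^sub>2) (b\<^sub>1 \<otimes>\<^sub>a b\<^sub>2) =
        koszul_sign grading grading a\<^sub>2 b\<^sub>1 *\<^sub>C ((a\<^sub>1 * b\<^sub>1) \<otimes>\<^sub>a (a\<^sub>2 * b\<^sub>2)))"
  note mD = cbilinearD[OF m[THEN conjunct1]] and nD = cbilinearD[OF n[THEN conjunct1]]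
  have "m s t = n s t" for s t
  proof (induction s rule: alg_tensor_homogeneous_induct)
    case (tensor a b)
    then show ?case
      by (induction t rule: alg_tensor_homogeneous_induct) (simp_all add: mD nD m n)
  qed (simp_all add: mD nD)
  then show "m = n" by blast
qed

lemmas fermi_times = theI'[OF ex1_fermi_times, folded fermi_times_def]

lemma ex1_fermi_star:
  "\<exists>!S. antilinear S \<and> (\<forall>a\<^sub>1 a\<^sub>2. homogeneous grading a\<^sub>1 \<and> homogeneous grading a\<^sub>2 \<longrightarrow>
      S ((a\<^sub>1::'a::z2_graded_star_algebra) \<otimes>\<^sub>a (a\<^sub>2::'b::z2_graded_star_algebra)) =
        koszul_sign grading grading a\<^sub>1 a\<^sub>2 *\<^sub>C (star a\<^sub>1 \<otimes>\<^sub>a star a\<^sub>2))"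
proof (rule ex_ex1I)
  have neg: "a \<otimes>\<^sub>a (- b) = - (a \<otimes>\<^sub>a b)" "(- a) \<otimes>\<^sub>a b = - (a \<otimes>\<^sub>a b)" for a :: 'a and b :: 'b
    using tensor_simps(2)[of a b "- b"] tensor_simps(1)[of a "- a" b]
    by (simp_all add: eq_neg_iff_add_eq_0 add.commute)
  have diff: "(a - a') \<otimes>\<^sub>a b = a \<otimes>\<^sub>a b - a' \<otimes>\<^sub>a b" for a a' :: 'a and b :: 'b
    using tensor_simps(1)[of a "- a'" b] by (simp add: neg)
  define h :: "'a \<Rightarrow> 'b \<Rightarrow> ('a, 'b) alg_tensor" where
    "h a b = ((1/2::complex) *\<^sub>C (star a + star (grading a))) \<otimes>\<^sub>a star b
      + ((1/2::complex) *\<^sub>C (star a - star (grading a))) \<otimes>\<^sub>a star (grading b)" for a b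
  note hsimps = h_def tensor_simps grading_add grading_scaleC star_add star_scaleC
    scaleC_add_right scaleC_scaleC mult.commute complex_vector.scale_right_diff_distrib diff
  have "\<exists>!L. antilinear L \<and> (\<forall>a b. L (a \<otimes>\<^sub>a b) = h a b)"
    by (rule ex1_antilinear_tensor; unfold antilinear_def; simp add: hsimps)
  then obtain L where L: "antilinear L" "\<And>a b. L (a \<otimes>\<^sub>a b) = h a b" by blast
  have "h a b = koszul_sign grading grading a b *\<^sub>C (star a \<otimes>\<^sub>a star b)"
    if hom: "homogeneous grading a" "homogeneous grading b" for a b
  proof (cases "grading a = a")
    case True
    then have "koszul_sign grading grading a b = 1 \<or> a = 0"
      using eq_uminus_imp_zero[of a] by (auto simp: koszul_sign_def)
    then show ?thesis
      using True by (auto simp: h_def scaleC_one half_sum scaleC_add_right)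
  next
    case False
    have star_neg: "star (- x) = - star x" for x :: "'c::star_algebra"
      using star_scaleC[of "- 1" x] by (simp add: complex_vector.scale_minus_left scaleC_one)
    from False have "grading a = - a" using hom by (auto simp: homogeneous_def)
    then show ?thesis
      using hom(2) eq_uminus_imp_zero[of b]
      by (auto simp: h_def scaleC_one half_sum scaleC_add_right koszul_sign_def homogeneous_def
          complex_vector.scale_minus_left neg star_neg)
  qed
  with L show "\<exists>S. antilinear S \<and> (\<forall>a\<^sub>1 a\<^sub>2. homogeneous grading a\<^sub>1 \<and> homogeneous grading a\<^sub>2 \<longrightarrow>
      S ((a\<^sub>1::'a) \<otimes>\<^sub>a (a\<^sub>2::'b)) =
        koszul_sign grading grading a\<^sub>1 a\<^sub>2 *\<^sub>C (star a\<^sub>1 \<otimes>\<^sub>a star a\<^sub>2))"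
    by auto
next
  fix S T :: "('a, 'b) alg_tensor \<Rightarrow> ('a, 'b) alg_tensor"
  assume S: "antilinear S \<and> (\<forall>a\<^sub>1 a\<^sub>2. homogeneous grading a\<^sub>1 \<and> homogeneous grading a\<^sub>2 \<longrightarrow>
      S (a\<^sub>1 \<otimes>\<^sub>a a\<^sub>2) = koszul_sign grading grading a\<^sub>1 a\<^sub>2 *\<^sub>C (star a\<^sub>1 \<otimes>\<^sub>a star a\<^sub>2))"
    and T: "antilinear T \<and> (\<forall>a\<^sub>1 a\<^sub>2. homogeneous grading a\<^sub>1 \<and> homogeneous grading a\<^sub>2 \<longrightarrow>
      T (a\<^sub>1 \<otimes>\<^sub>a a\<^sub>2) = koszul_sign grading grading a\<^sub>1 a\<^sub>2 *\<^sub>C (star a\<^sub>1 \<otimes>\<^sub>a star a\<^sub>2))"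
  have add: "S (x + y) = S x + S y" "T (x + y) = T x + T y" for x y
    using S T by (simp_all add: antilinear_def)
  then have "S 0 = 0" "T 0 = 0" by (metis add_cancel_right_right)+
  then have "S x = T x" for x
    by (induction x rule: alg_tensor_homogeneous_induct) (simp_all add: add S T)
  then show "S = T" by blast
qed

lemmas fermi_star = theI'[OF ex1_fermi_star, folded fermi_star_def]

lemma fermi_times_tensor:
  assumes "has_grade s a\<^sub>2" "has_grade t b\<^sub>1"
  shows "fermi_times (a\<^sub>1 \<otimes>\<^sub>a a\<^sub>2) (b\<^sub>1 \<otimes>\<^sub>a b\<^sub>2) = grade_sign s t *\<^sub>C ((a\<^sub>1 * b\<^sub>1) \<otimes>\<^sub>a (a\<^sub>2 * b\<^sub>2))"
proof (cases "a\<^sub>2 = 0 \<or> b\<^sub>1 = 0")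
  case True
  then show ?thesis by (auto simp: cbilinearD[OF fermi_times[THEN conjunct1]])
next
  case False
  then show ?thesis
    using fermi_times[THEN conjunct2, rule_format, of a\<^sub>2 b\<^sub>1 a\<^sub>1 b\<^sub>2] assms
    by (simp add: koszul_sign_grading has_grade_homogeneous)
qed

lemma fermi_star_add: "fermi_star (x + y) = fermi_star x + fermi_star y"
  and fermi_star_scaleC: "fermi_star (c *\<^sub>C x) = cnj c *\<^sub>C fermi_star x"
  for x y :: "('a::z2_graded_star_algebra, 'b::z2_graded_star_algebra) alg_tensor"
  using fermi_star[where 'a='a and 'b='b, THEN conjunct1] by (simp_all add: antilinear_def)

lemma fermi_star_zero: "fermi_star 0 = 0"
  using fermi_star_add[of 0 0] by simp

lemma fermi_star_tensor:
  assumes "has_grade s a\<^sub>1" "has_grade t a\<^sub>2"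
  shows "fermi_star (a\<^sub>1 \<otimes>\<^sub>a a\<^sub>2) = grade_sign s t *\<^sub>C (star a\<^sub>1 \<otimes>\<^sub>a star a\<^sub>2)"
proof (cases "a\<^sub>1 = 0 \<or> a\<^sub>2 = 0")
  case True
  then show ?thesis by (auto simp: fermi_star_zero)
next
  case False
  then show ?thesis
    using fermi_star[THEN conjunct2, rule_format, of a\<^sub>1 a\<^sub>2] assms
    by (simp add: koszul_sign_grading has_grade_homogeneous)
qed

instantiation alg_tensor :: (z2_graded_star_algebra, z2_graded_star_algebra) star_algebra
begin

definition "times_alg_tensor = (fermi_times ::
  ('a, 'b) alg_tensor \<Rightarrow> ('a, 'b) alg_tensor \<Rightarrow> ('a, 'b) alg_tensor)"

definition "one_alg_tensor = (1 \<otimes>\<^sub>a 1 :: ('a, 'b) alg_tensor)"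

definition "star_alg_tensor = (fermi_star :: ('a, 'b) alg_tensor \<Rightarrow> ('a, 'b) alg_tensor)"

instance
proof
  note m = cbilinearD[OF fermi_times[THEN conjunct1]]
  fix x y z :: "('a, 'b) alg_tensor" and c :: complex
  show "(x + y) * z = x * z + y * z" "x * (y + z) = x * y + x * z"
    "(c *\<^sub>C x) * y = c *\<^sub>C (x * y)" "x * (c *\<^sub>C y) = c *\<^sub>C (x * y)"
    by (simp_all add: times_alg_tensor_def m)
  show "star (x + y) = star x + star y" "star (c *\<^sub>C x) = cnj c *\<^sub>C star x"
    by (simp_all add: star_alg_tensor_def fermi_star_add fermi_star_scaleC)
  show "1 * x = x"
    unfolding times_alg_tensor_def one_alg_tensor_def
  proof (induction x rule: alg_tensor_homogeneous_induct)
    case (tensor a b)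
    then obtain s where "has_grade s a" by (rule_tac homogeneous_has_grade)
    then show ?case
      by (simp add: fermi_times_tensor[OF has_grade_one] grade_sign_def scaleC_one)
  qed (simp_all add: m)
  show "x * 1 = x"
    unfolding times_alg_tensor_def one_alg_tensor_def
  proof (induction x rule: alg_tensor_homogeneous_induct)
    case (tensor a b)
    then obtain s where "has_grade s b" by (rule_tac homogeneous_has_grade)
    then show ?case
      by (simp add: fermi_times_tensor[OF _ has_grade_one] grade_sign_def scaleC_one)
  qed (simp_all add: m)
  have sign_cong: "p *\<^sub>C w = q *\<^sub>C w" if "p = q" for p q and w :: "('a, 'b) alg_tensor"
    using that by simp
  show "x * y * z = x * (y * z)"
    unfolding times_alg_tensor_def
  proof (induction x rule: alg_tensor_homogeneous_induct)
    case (tensor a1 a2)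
    then obtain s where a: "has_grade s a2" by (rule_tac homogeneous_has_grade)
    show ?case
    proof (induction y rule: alg_tensor_homogeneous_induct)
      case (tensor b1 b2)
      then obtain t u where b: "has_grade t b1" "has_grade u b2" by (metis homogeneous_has_grade)
      show ?case
      proof (induction z rule: alg_tensor_homogeneous_induct)
        case (tensor c1 c2)
        then obtain v where c: "has_grade v c1" by (rule_tac homogeneous_has_grade)
        show ?case
          unfolding fermi_times_tensor[OF a b(1)] fermi_times_tensor[OF b(2) c] m
            fermi_times_tensor[OF a has_grade_mult[OF b(1) c]]
            fermi_times_tensor[OF has_grade_mult[OF a b(2)] c] scaleC_scaleC mult.assoc
          using has_gradeD[OF a] has_gradeD[OF b(1)] has_gradeD[OF b(2)] has_gradeD[OF c]
          by (intro sign_cong) (auto simp: grade_sign_def)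
      qed (simp_all add: m)
    qed (simp_all add: m)
  qed (simp_all add: m)
  show "star (star x) = x"
    unfolding star_alg_tensor_def
  proof (induction x rule: alg_tensor_homogeneous_induct)
    case (tensor a b)
    then obtain s t where a: "has_grade s a" "has_grade t b" by (metis homogeneous_has_grade)
    show ?case
      unfolding fermi_star_tensor[OF a] fermi_star_scaleC
        fermi_star_tensor[OF a[THEN has_grade_star]] scaleC_scaleC
      by (simp add: grade_sign_def star_star scaleC_one)
  qed (simp_all add: fermi_star_zero fermi_star_add)
  show "star (x * y) = star y * star x"
    unfolding star_alg_tensor_def times_alg_tensor_def
  proof (induction x rule: alg_tensor_homogeneous_induct)
    case (tensor a1 a2)
    then obtain s t where a: "has_grade s a1" "has_grade t a2" by (metis homogeneous_has_grade)
    show ?case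
    proof (induction y rule: alg_tensor_homogeneous_induct)
      case (tensor b1 b2)
      then obtain u v where b: "has_grade u b1" "has_grade v b2" by (metis homogeneous_has_grade)
      show ?case
        unfolding fermi_times_tensor[OF a(2) b(1)] fermi_star_scaleC fermi_star_tensor[OF a]
          fermi_star_tensor[OF b] m
          fermi_times_tensor[OF b(2)[THEN has_grade_star] a(1)[THEN has_grade_star]]
          fermi_star_tensor[OF has_grade_mult[OF a(1) b(1)] has_grade_mult[OF a(2) b(2)]]
          scaleC_scaleC star_mult
        using has_gradeD[OF a(1)] has_gradeD[OF a(2)] has_gradeD[OF b(1)] has_gradeD[OF b(2)]
        by (intro sign_cong) (auto simp: grade_sign_def)
    qed (simp_all add: m fermi_star_zero fermi_star_add)
  qed (simp_all add: m fermi_star_zero fermi_star_add)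
qed

end


section \<open>States and GNS triples\<close>

definition state :: "('a::unital_cstar_algebra \<Rightarrow> complex) \<Rightarrow> bool" where
  "state \<omega> \<longleftrightarrow> clinear \<omega> \<and> (\<forall>a. \<omega> (star a * a) \<in> \<real>\<^sub>\<ge>\<^sub>0) \<and> \<omega> 1 = 1"

definition even_state :: "('a::z2_graded_cstar_algebra \<Rightarrow> complex) \<Rightarrow> bool" where
  "even_state \<omega> \<longleftrightarrow> state \<omega> \<and> \<omega> \<circ> grading = \<omega>"

definition product_functional :: "('a::complex_vector \<Rightarrow> complex) \<Rightarrow> ('b::complex_vector \<Rightarrow> complex)
    \<Rightarrow> ('a, 'b) alg_tensor \<Rightarrow> complex" where
  "product_functional \<omega>\<^sub>1 \<omega>\<^sub>2 = tensor_lift (\<lambda>a\<^sub>1 a\<^sub>2. \<omega>\<^sub>1 a\<^sub>1 * \<omega>\<^sub>2 a\<^sub>2)"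

lemma product_functional_tensor:
  assumes "clinear \<omega>\<^sub>1" "clinear \<omega>\<^sub>2"
  shows "clinear (product_functional \<omega>\<^sub>1 \<omega>\<^sub>2)"
    and "product_functional \<omega>\<^sub>1 \<omega>\<^sub>2 (a\<^sub>1 \<otimes>\<^sub>a a\<^sub>2) = \<omega>\<^sub>1 a\<^sub>1 * \<omega>\<^sub>2 a\<^sub>2"
proof -
  have "cbilinear (\<lambda>a\<^sub>1 a\<^sub>2. \<omega>\<^sub>1 a\<^sub>1 * \<omega>\<^sub>2 a\<^sub>2)"
    using assms by (simp add: cbilinear_def clinear_def scaleC_complex_def algebra_simps)
  then show "clinear (product_functional \<omega>\<^sub>1 \<omega>\<^sub>2)"
    and "product_functional \<omega>\<^sub>1 \<omega>\<^sub>2 (a\<^sub>1 \<otimes>\<^sub>a a\<^sub>2) = \<omega>\<^sub>1 a\<^sub>1 * \<omega>\<^sub>2 a\<^sub>2"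
    unfolding product_functional_def by (rule clinear_tensor_lift, rule tensor_lift_tensor)
qed

text \<open>
  Representations act by bounded operators; this is part of the requirement also on the purely
  algebraic Fermi tensor product, which carries no norm.
\<close>

definition star_representation :: "('a::star_algebra \<Rightarrow> 'h::chilbert_space \<Rightarrow> 'h) \<Rightarrow> bool" where
  "star_representation \<pi> \<longleftrightarrow>
    (\<forall>a. bounded_clinear (\<pi> a)) \<and>
    (\<forall>a b x. \<pi> (a + b) x = \<pi> a x + \<pi> b x) \<and>
    (\<forall>c a x. \<pi> (c *\<^sub>C a) x = c *\<^sub>C \<pi> a x) \<and>
    (\<forall>a b. \<pi> (a * b) = \<pi> a \<circ> \<pi> b) \<and>
    (\<forall>a x y. cinner (\<pi> (star a) x) y = cinner x (\<pi> a y))"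

text \<open>
  A GNS triple is only determined up to unitary equivalence, so it is a predicate rather than a
  chosen model; \<open>\<xi>\<close> is cyclic and implements \<open>\<omega>\<close>.
\<close>

definition gns_triple ::
  "('a::star_algebra \<Rightarrow> complex) \<Rightarrow> ('a \<Rightarrow> 'h::chilbert_space \<Rightarrow> 'h) \<Rightarrow> 'h \<Rightarrow> bool" where
  "gns_triple \<omega> \<pi> \<xi> \<longleftrightarrow>
    star_representation \<pi> \<and>
    closure (range (\<lambda>a. \<pi> a \<xi>)) = UNIV \<and>
    (\<forall>a. \<omega> a = cinner \<xi> (\<pi> a \<xi>))"

text \<open>The self-adjoint unitary implementing the grading on the GNS space of an even state.\<close>

definition gns_grading ::
  "('a::z2_graded_cstar_algebra \<Rightarrow> 'h::chilbert_space \<Rightarrow> 'h) \<Rightarrow> 'h \<Rightarrow> 'h \<Rightarrow> 'h" where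
  "gns_grading \<pi> \<xi> =
    (THE V. self_adjoint_unitary V \<and> (\<forall>a. V (\<pi> a \<xi>) = \<pi> (grading a) \<xi>))"

definition unitarily_equivalent ::
  "('a \<Rightarrow> 'h::chilbert_space \<Rightarrow> 'h) \<Rightarrow> ('a \<Rightarrow> 'k::chilbert_space \<Rightarrow> 'k) \<Rightarrow> bool" where
  "unitarily_equivalent \<pi> \<rho> \<longleftrightarrow> (\<exists>W. unitary W \<and> (\<forall>a. W \<circ> \<pi> a = \<rho> a \<circ> W))"


section \<open>Fermi tensor products of operators and representations\<close>

text \<open>
  \<open>t x y\<close> stands for \<open>x \<otimes> y\<close>, and the target type for the Hilbert space tensor product, that is, as the completion of the
  algebraic tensor product with \<open>\<langle>x \<otimes> y, x' \<otimes> y'\<rangle> = \<langle>x, x'\<rangle> \<langle>y, y'\<rangle>\<close>.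
\<close>

definition hilbert_tensor_product ::
  "('h::chilbert_space \<Rightarrow> 'k::chilbert_space \<Rightarrow> 'l::chilbert_space) \<Rightarrow> bool" where
  "hilbert_tensor_product t \<longleftrightarrow>
    cbilinear t \<and>
    (\<forall>x y x' y'. cinner (t x y) (t x' y') = cinner x x' * cinner y y') \<and>
    closure (cspan {t x y | x y. True}) = UNIV"

text \<open>The adjoint action \<open>U T U\<^sup>*\<close>, where \<open>U\<^sup>* = U\<close> for a self-adjoint unitary \<open>U\<close>.\<close>

definition ad :: "('h \<Rightarrow> 'h) \<Rightarrow> ('h \<Rightarrow> 'h) \<Rightarrow> 'h \<Rightarrow> 'h" where
  "ad U T = U \<circ> T \<circ> U"

definition op_even :: "('h::complex_vector \<Rightarrow> 'h) \<Rightarrow> ('h \<Rightarrow> 'h) \<Rightarrow> 'h \<Rightarrow> 'h" where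
  "op_even U T x = (1/2::complex) *\<^sub>C (T x + ad U T x)"

definition op_odd :: "('h::complex_vector \<Rightarrow> 'h) \<Rightarrow> ('h \<Rightarrow> 'h) \<Rightarrow> 'h \<Rightarrow> 'h" where
  "op_odd U T x = (1/2::complex) *\<^sub>C (T x - ad U T x)"

text \<open>
  The operator for homogeneous \<open>T\<^sub>2\<close>. In the sign, \<open>ad U\<^sub>2 T\<^sub>2 = - T\<^sub>2\<close> uses the pointwise negation
  of functions.
\<close>

definition fermi_op_homogeneous ::
  "('h::chilbert_space \<Rightarrow> 'k::chilbert_space \<Rightarrow> 'l::chilbert_space) \<Rightarrow> ('h \<Rightarrow> 'h) \<Rightarrow> ('k \<Rightarrow> 'k)
    \<Rightarrow> ('h \<Rightarrow> 'h) \<Rightarrow> ('k \<Rightarrow> 'k) \<Rightarrow> 'l \<Rightarrow> 'l" where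
  "fermi_op_homogeneous t U\<^sub>1 U\<^sub>2 T\<^sub>1 T\<^sub>2 =
    (THE T. bounded_clinear T \<and>
      (\<forall>x y. homogeneous U\<^sub>1 x \<longrightarrow>
        T (t x y) = koszul_sign (ad U\<^sub>2) U\<^sub>1 T\<^sub>2 x *\<^sub>C t (T\<^sub>1 x) (T\<^sub>2 y)))"

definition fermi_op ::
  "('h::chilbert_space \<Rightarrow> 'k::chilbert_space \<Rightarrow> 'l::chilbert_space) \<Rightarrow> ('h \<Rightarrow> 'h) \<Rightarrow> ('k \<Rightarrow> 'k)
    \<Rightarrow> ('h \<Rightarrow> 'h) \<Rightarrow> ('k \<Rightarrow> 'k) \<Rightarrow> 'l \<Rightarrow> 'l" where
  "fermi_op t U\<^sub>1 U\<^sub>2 T\<^sub>1 T\<^sub>2 z =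
    fermi_op_homogeneous t U\<^sub>1 U\<^sub>2 T\<^sub>1 (op_even U\<^sub>2 T\<^sub>2) z
    + fermi_op_homogeneous t U\<^sub>1 U\<^sub>2 T\<^sub>1 (op_odd U\<^sub>2 T\<^sub>2) z"

definition fermi_representation ::
  "('h::chilbert_space \<Rightarrow> 'k::chilbert_space \<Rightarrow> 'l::chilbert_space) \<Rightarrow> ('h \<Rightarrow> 'h) \<Rightarrow> ('k \<Rightarrow> 'k)
    \<Rightarrow> ('a::complex_vector \<Rightarrow> 'h \<Rightarrow> 'h) \<Rightarrow> ('b::complex_vector \<Rightarrow> 'k \<Rightarrow> 'k)
    \<Rightarrow> ('a, 'b) alg_tensor \<Rightarrow> 'l \<Rightarrow> 'l" where
  "fermi_representation t U\<^sub>1 U\<^sub>2 \<pi>\<^sub>1 \<pi>\<^sub>2 x z =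
    tensor_lift (\<lambda>a\<^sub>1 a\<^sub>2. fermi_op t U\<^sub>1 U\<^sub>2 (\<pi>\<^sub>1 a\<^sub>1) (\<pi>\<^sub>2 a\<^sub>2) z) x"

end

theory Submission
  imports Defs
begin

text \<open>
  On homogeneous elementary tensors the inner product \<open>\<langle>\<pi>(a\<^sub>1 \<otimes> a\<^sub>2)\<xi>, \<pi>(b\<^sub>1 \<otimes> b\<^sub>2)\<xi>\<rangle>\<close> is
  \<open>\<epsilon>(a\<^sub>1, a\<^sub>2) \<epsilon>(a\<^sub>2, b\<^sub>1) \<omega>\<^sub>1(a\<^sub>1\<^sup>* b\<^sub>1) \<omega>\<^sub>2(a\<^sub>2\<^sup>* b\<^sub>2)\<close>. Evenness of \<open>\<omega>\<^sub>1\<close> makes it vanish unless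
  \<open>a\<^sub>1\<close> and \<open>b\<^sub>1\<close> have the same grade, and then the two signs cancel. Hence
  \<open>\<pi>(a\<^sub>1 \<otimes> a\<^sub>2)\<xi> \<mapsto> \<pi>\<^sub>1(a\<^sub>1)\<xi>\<^sub>1 \<otimes> \<pi>\<^sub>2(a\<^sub>2)\<xi>\<^sub>2\<close> extends to a unitary \<open>W\<close>. The bounded operator
  \<open>W \<pi>(a\<^sub>1 \<otimes> a\<^sub>2) W\<^sup>*\<close> acts on vectors \<open>\<pi>\<^sub>1(b\<^sub>1)\<xi>\<^sub>1 \<otimes> \<pi>\<^sub>2(b\<^sub>2)\<xi>\<^sub>2\<close> by the formula defining
  \<open>\<pi>\<^sub>1(a\<^sub>1) \<otimes>\<^sub>F \<pi>\<^sub>2(a\<^sub>2)\<close>, so by density the two operators coincide. In particular the existence of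
  the Fermi tensor product of these operators comes for free.
\<close>

section \<open>Density and linear-algebra preliminaries\<close>

text \<open>The equalizer of two continuous maps into a Hausdorff space is closed. Operator
  identities are reduced in this way to cyclic orbits or elementary tensors, where they are
  algebraic.\<close>

lemma continuous_eq_on_dense:
  fixes f g :: "'x::topological_space \<Rightarrow> 'y::t2_space"
  assumes "continuous_on UNIV f" "continuous_on UNIV g" "closure S = UNIV"
    and "\<And>x. x \<in> S \<Longrightarrow> f x = g x"
  shows "f x = g x"
proof -
  have "closure S \<subseteq> {x. f x = g x}"
    using assms by (intro closure_minimal closed_Collect_eq) auto
  then show ?thesis using assms(3) by blast
qed

lemma clinearD:
  assumes "clinear f"
  shows "f (x + y) = f x + f y" "f (c *\<^sub>C x) = c *\<^sub>C f x" "f 0 = 0" "f (x - y) = f x - f y"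
proof -
  show *: "f (x + y) = f x + f y" "f (c *\<^sub>C x) = c *\<^sub>C f x" for x y c
    using assms by (simp_all add: clinear_def)
  show "f 0 = 0" using *(1)[of 0 0] by simp
  show "f (x - y) = f x - f y" using *(1)[of "x - y" y] by simp
qed

lemma clinear_compose: "clinear f \<Longrightarrow> clinear g \<Longrightarrow> clinear (\<lambda>x. f (g x))"
  by (simp add: clinear_def)

lemma involution_decomp:
  fixes x :: "'x::complex_vector"
  assumes "clinear U" "\<And>x. U (U x) = x"
  obtains y z where "x = y + z" "U y = y" "U z = - z"
proof
  let ?y = "(1/2::complex) *\<^sub>C (x + U x)" and ?z = "(1/2::complex) *\<^sub>C (x - U x)"
  have "?y + ?z = (1/2::complex) *\<^sub>C x + (1/2) *\<^sub>C x"
    by (simp add: scaleC_add_right complex_vector.scale_right_diff_distrib)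
  then show "x = ?y + ?z" by (simp add: half_sum)
  show "U ?y = ?y"
    by (simp add: clinearD[OF assms(1)] assms(2) add.commute)
  show "U ?z = - ?z"
    by (simp add: clinearD[OF assms(1)] assms(2) flip: complex_vector.scale_minus_right)
qed


section \<open>Inner products and bounded operators\<close>

lemma cinner_add_left: "cinner (x + y) z = cinner x z + cinner y z"
  by (metis cinner_add_right cinner_commute complex_cnj_add)

lemma cinner_scaleC_left: "cinner (c *\<^sub>C x) y = cnj c * cinner x y"
  by (metis cinner_scaleC_right cinner_commute complex_cnj_mult)

lemma cinner_zero [simp]: "cinner 0 x = 0" "cinner x 0 = 0"
  using cinner_add_left[of 0 0 x] cinner_add_right[of x 0 0] by simp_all

lemma cinner_self: "cinner x x = of_real ((norm x)\<^sup>2)"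
proof -
  from cinner_nonneg[of x] have "cinner x x = of_real (cmod (cinner x x))"
    by (auto simp: nonneg_Reals_def)
  then show ?thesis by (simp add: norm_eq_sqrt_cinner)
qed

lemma norm_eqI_cinner:
  assumes "cinner x x = cinner y y"
  shows "norm x = norm y"
  using assms by (simp add: norm_eq_sqrt_cinner)

lemma norm_scaleC_chilbert: "norm (c *\<^sub>C (x :: 'x::chilbert_space)) = cmod c * norm x"
  by (simp add: norm_eq_sqrt_cinner cinner_scaleC_left cinner_scaleC_right norm_mult
      real_sqrt_mult flip: mult.assoc power2_eq_square)

text \<open>Three of the four norms are kept in the shape \<open>x + c *\<^sub>C y\<close>, so that
  a linear isometry can be pulled out of each by the same rewrite.\<close>

lemma polarization:
  "4 * cinner x y = of_real ((norm (x + y))\<^sup>2) - of_real ((norm (x + (-1) *\<^sub>C y))\<^sup>2)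
    - \<i> * of_real ((norm (x + \<i> *\<^sub>C y))\<^sup>2) + \<i> * of_real ((norm (x + (- \<i>) *\<^sub>C y))\<^sup>2)"
  unfolding cinner_self[symmetric]
  by (simp only: cinner_add_left cinner_add_right cinner_scaleC_left cinner_scaleC_right)
    (simp add: algebra_simps)

lemma clinear_isometry_cinner:
  assumes "clinear f" "\<And>x. norm (f x) = norm x"
  shows "cinner (f x) (f y) = cinner x y"
proof -
  have "norm (f x + c *\<^sub>C f y) = norm (x + c *\<^sub>C y)" "norm (f x + f y) = norm (x + y)" for c
    using assms(2) by (simp_all flip: clinearD[OF assms(1)])
  then have "4 * cinner (f x) (f y) = 4 * cinner x y"
    unfolding polarization by (simp only:)
  then show ?thesis by simp
qed

lemma bounded_clinear_bounded_linear:
  assumes "bounded_clinear f"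
  shows "bounded_linear f"
proof -
  obtain K where "clinear f" "\<And>x. norm (f x) \<le> K * norm x"
    using assms by (auto simp: bounded_clinear_def)
  then show ?thesis
    by (auto intro!: bounded_linear_intro[of f K] simp: clinearD scaleR_scaleC mult.commute)
qed

lemma bounded_clinearI:
  assumes "clinear f" "bounded_linear f"
  shows "bounded_clinear f"
  using assms(1) bounded_linear.bounded[OF assms(2)]
  by (auto simp: bounded_clinear_def mult.commute)

lemma bounded_clinear_continuous: "bounded_clinear f \<Longrightarrow> continuous_on S f"
  by (intro linear_continuous_on bounded_clinear_bounded_linear)

lemma bounded_clinear_compose:
  assumes "bounded_clinear f" "bounded_clinear g"
  shows "bounded_clinear (\<lambda>x. f (g x))"
proof (rule bounded_clinearI)
  show "clinear (\<lambda>x. f (g x))"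
    using assms by (auto simp: bounded_clinear_def intro: clinear_compose)
  show "bounded_linear (\<lambda>x. f (g x))"
    using assms by (intro bounded_linear_compose[of f g] bounded_clinear_bounded_linear)
qed

lemma bounded_clinear_scaleC: "bounded_clinear (\<lambda>x :: 'x::chilbert_space. c *\<^sub>C x)"
  by (auto simp: bounded_clinear_def clinear_def norm_scaleC_chilbert scaleC_add_right
      scaleC_scaleC mult.commute[of c] intro!: exI[of _ "cmod c"])

lemma unitary_norm: "unitary W \<Longrightarrow> norm (W x) = norm x"
  unfolding unitary_def by (intro norm_eqI_cinner) auto

lemma unitary_bounded_clinear:
  assumes "unitary W"
  shows "bounded_clinear W"
  using assms unitary_norm[OF assms]
  by (auto simp: bounded_clinear_def unitary_def intro!: exI[of _ 1])

lemma unitary_inv: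
  assumes "unitary W"
  shows "bounded_clinear (inv W)" "inv W (W x) = x" "W (inv W y) = y"
proof -
  have lin: "clinear W" and "surj W" using assms by (auto simp: unitary_def)
  have "inj W"
    using unitary_norm[OF assms] by (intro injI) (metis clinearD(4)[OF lin] eq_iff_diff_eq_0 norm_eq_zero)
  show inv: "inv W (W x) = x" "W (inv W y) = y" for x y
    using \<open>inj W\<close> \<open>surj W\<close> by (simp_all add: surj_f_inv_f)
  have "clinear (inv W)"
    unfolding clinear_def by (metis inv clinearD(1,2)[OF lin])
  moreover have "norm (inv W x) \<le> 1 * norm x" for x
    using unitary_norm[OF assms, of "inv W x"] by (simp add: inv)
  ultimately show "bounded_clinear (inv W)"
    unfolding bounded_clinear_def by blast
qed

text \<open>\<open>f\<close> and \<open>h\<close> parametrise two dense subspaces by one vector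
  space. Equal norms make \<open>f a \<mapsto> h a\<close> a well-defined isometry, which extends by
  uniform continuity. It yields both the grading unitary of a GNS space and the final
  intertwiner.\<close>

lemma unitary_extension:
  fixes f :: "'i::complex_vector \<Rightarrow> 'g::chilbert_space" and h :: "'i \<Rightarrow> 'l::chilbert_space"
  assumes f: "clinear f" and h: "clinear h"
    and iso: "\<And>a. norm (h a) = norm (f a)"
    and df: "closure (range f) = UNIV" and dh: "closure (range h) = UNIV"
  obtains W where "unitary W" "\<And>a. W (f a) = h a"
proof -
  have dist: "dist (h a) (h b) = dist (f a) (f b)" for a b
    using iso[of "a - b"] by (simp add: dist_norm clinearD(4)[OF f] clinearD(4)[OF h])
  \<comment> \<open>\<open>inv f\<close> picks an arbitrary preimage; \<open>dist\<close> shows that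
    the value of \<open>h\<close> does not depend on the choice.\<close>
  define g where "g x = h (inv f x)" for x
  have gf: "g (f a) = h a" for a
    using dist[of "inv f (f a)" a] unfolding g_def by (simp add: f_inv_into_f)
  have "uniformly_continuous_on (range f) g"
    unfolding uniformly_continuous_on_def by (auto simp: gf dist)
  then obtain W where W: "uniformly_continuous_on (closure (range f)) W"
    and Wg: "\<And>x. x \<in> range f \<Longrightarrow> g x = W x"
    by (rule uniformly_continuous_on_extension_on_closure) blast
  then have cont: "continuous_on UNIV W"
    using uniformly_continuous_imp_continuous df by force
  have Wf: "W (f a) = h a" for a
    using Wg[of "f a"] gf by simp
  have norm: "norm (W x) = norm x" for x
    by (rule continuous_eq_on_dense[OF _ _ df])
      (auto intro!: continuous_intros cont simp: Wf iso)
  \<comment> \<open>Additivity is treated as an equality of two continuous functions of the pair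
    \<open>p\<close>.\<close>
  have "closure (range f \<times> range f) = UNIV"
    by (simp add: closure_Times df)
  then have "W (fst p + snd p) = W (fst p) + W (snd p)" for p
    by (rule continuous_eq_on_dense[rotated 2])
      (auto intro!: continuous_intros continuous_on_compose2[OF cont]
        simp: Wf clinearD(1)[OF h] simp flip: clinearD(1)[OF f])
  then have add: "W (x + y) = W x + W y" for x y
    by (metis fst_conv snd_conv)
  have scale_cont: "continuous_on UNIV (\<lambda>x. c *\<^sub>C (x :: 'x::chilbert_space))" for c
    by (intro bounded_clinear_continuous bounded_clinear_scaleC)
  have scale: "W (c *\<^sub>C x) = c *\<^sub>C W x" for c x
    by (rule continuous_eq_on_dense[OF _ _ df])
      (auto intro!: continuous_on_compose2[OF cont] continuous_on_compose2[OF scale_cont]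
        cont scale_cont
        simp: Wf clinearD(2)[OF h] simp flip: clinearD(2)[OF f])
  have lin: "clinear W" by (simp add: clinear_def add scale)
  then have "bounded_linear W"
    by (intro bounded_clinear_bounded_linear)
      (auto simp: bounded_clinear_def norm intro!: exI[of _ 1])
  \<comment> \<open>An isometric image of a complete space is closed; since it contains the dense
    range of \<open>h\<close>, it is everything.\<close>
  then have "complete (W ` UNIV)"
    by (intro complete_isometric_image[of 1]) (auto simp: norm complete_UNIV)
  then have "closed (range W)" by (rule complete_imp_closed)
  moreover have "range h \<subseteq> range W" using Wf by (metis image_subsetI rangeI)
  ultimately have "surj W" using dh closure_minimal by blast
  with lin clinear_isometry_cinner[OF lin norm] have "unitary W"
    unfolding unitary_def by blast
  then show ?thesis using Wf that by blast
qed


section \<open>GNS triples\<close>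

lemma gns_tripleD:
  assumes "gns_triple \<omega> \<pi> \<xi>"
  shows "bounded_clinear (\<pi> a)" "clinear (\<lambda>a. \<pi> a x)" "\<pi> (a * b) x = \<pi> a (\<pi> b x)"
    "closure (range (\<lambda>a. \<pi> a \<xi>)) = UNIV" "cinner (\<pi> a \<xi>) (\<pi> b \<xi>) = \<omega> (star a * b)"
proof -
  have r: "star_representation \<pi>" and \<omega>: "\<And>a. \<omega> a = cinner \<xi> (\<pi> a \<xi>)"
    and "closure (range (\<lambda>a. \<pi> a \<xi>)) = UNIV"
    using assms by (auto simp: gns_triple_def)
  show "bounded_clinear (\<pi> a)" "clinear (\<lambda>a. \<pi> a x)"
    using r by (auto simp: star_representation_def clinear_def)
  show mult: "\<pi> (a * b) x = \<pi> a (\<pi> b x)" for a b x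
    using r by (simp add: star_representation_def)
  show "closure (range (\<lambda>a. \<pi> a \<xi>)) = UNIV" by fact
  have "cinner (\<pi> (star (star a)) \<xi>) (\<pi> b \<xi>) = cinner \<xi> (\<pi> (star a) (\<pi> b \<xi>))"
    using r unfolding star_representation_def by blast
  then show "cinner (\<pi> a \<xi>) (\<pi> b \<xi>) = \<omega> (star a * b)"
    by (simp add: star_star \<omega> mult)
qed

text \<open>Evenness makes \<open>\<pi> a \<xi> \<mapsto> \<pi> (grading a) \<xi>\<close> isometric,
  so it extends to a unitary, and cyclicity of \<xi> makes that unitary unique, which resolves the
  \<open>THE\<close>. The covariance under \<open>ad V\<close> matches the grades of algebra
  elements with those of operators.\<close>

lemma gns_grading_properties:
  fixes \<omega> :: "'a::z2_graded_cstar_algebra \<Rightarrow> complex"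
  assumes "even_state \<omega>" and gns: "gns_triple \<omega> \<pi> \<xi>"
  defines "V \<equiv> gns_grading \<pi> \<xi>"
  shows "unitary V" "V (\<pi> a \<xi>) = \<pi> (grading a) \<xi>" "V (V x) = x"
    "ad V (\<pi> a) = \<pi> (grading a)"
proof -
  note D = gns_tripleD[OF gns]
  have \<omega>: "\<omega> (grading a) = \<omega> a" for a
    using assms(1) by (metis even_state_def comp_apply)
  have grading: "clinear (\<lambda>a. \<pi> (grading a) \<xi>)"
    using D(2) by (simp add: clinear_def grading_add grading_scaleC)
  have range: "range (\<lambda>a. \<pi> (grading a) \<xi>) = range (\<lambda>a. \<pi> a \<xi>)"
  proof -
    have "surj (grading :: 'a \<Rightarrow> 'a)" by (rule surjI) (rule grading_grading)
    then show ?thesis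
      using image_image[of "\<lambda>a. \<pi> a \<xi>" grading UNIV] by simp
  qed
  have iso: "norm (\<pi> (grading a) \<xi>) = norm (\<pi> a \<xi>)" for a
    using \<omega>[of "star a * a"]
    by (intro norm_eqI_cinner) (simp add: D(5) grading_mult grading_star)
  obtain U where U: "unitary U" "\<And>a. U (\<pi> a \<xi>) = \<pi> (grading a) \<xi>"
    by (rule unitary_extension[OF D(2) grading iso D(4)]) (use range D(4) in auto)
  note bU = unitary_bounded_clinear[OF U(1)]
  have UU: "U (U x) = x" for x
  proof (rule continuous_eq_on_dense[where f = "\<lambda>x. U (U x)" and g = "\<lambda>x. x", OF _ _ D(4)])
    show "continuous_on UNIV (\<lambda>x. U (U x))"
      by (rule bounded_clinear_continuous[OF bounded_clinear_compose[OF bU bU]])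
  qed (auto simp: U(2) grading_grading)
  \<comment> \<open>For an involutive isometry, <Ux, y> = <Ux, UUy> = <x, Uy>.\<close>
  have "cinner (U x) y = cinner x (U y)" for x y
    using U(1) UU unfolding unitary_def by metis
  then have sa: "self_adjoint_unitary U"
    using U(1) by (simp add: self_adjoint_unitary_def)
  have "V = U"
    unfolding V_def gns_grading_def
  proof (rule the_equality)
    fix U' assume U': "self_adjoint_unitary U' \<and> (\<forall>a. U' (\<pi> a \<xi>) = \<pi> (grading a) \<xi>)"
    then have "continuous_on UNIV U'"
      by (intro bounded_clinear_continuous unitary_bounded_clinear) (simp add: self_adjoint_unitary_def)
    then have "U' x = U x" for x
      by (rule continuous_eq_on_dense[where f = U' and g = U, OF _ bounded_clinear_continuous[OF bU] D(4)]) (use U' U(2) in auto)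
    then show "U' = U" by blast
  qed (simp add: sa U)
  then show "unitary V" "V (\<pi> a \<xi>) = \<pi> (grading a) \<xi>" "V (V x) = x"
    by (simp_all add: U UU)
  \<comment> \<open>On the orbit vector \<open>\<pi> b \<xi>\<close> both sides equal
    \<open>\<pi> (grading a * b) \<xi>\<close>.\<close>
  have "U (\<pi> a (U x)) = \<pi> (grading a) x" for x
  proof (rule continuous_eq_on_dense[where f = "\<lambda>x. U (\<pi> a (U x))", OF _ _ D(4)])
    show "continuous_on UNIV (\<lambda>x. U (\<pi> a (U x)))"
      by (rule bounded_clinear_continuous[OF bounded_clinear_compose[OF bU
              bounded_clinear_compose[OF D(1) bU]]])
    show "continuous_on UNIV (\<pi> (grading a))"
      by (intro bounded_clinear_continuous D(1))
    show "U (\<pi> a (U x)) = \<pi> (grading a) x" if "x \<in> range (\<lambda>b. \<pi> b \<xi>)" for x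
      using that by (auto simp: U(2) grading_grading grading_mult simp flip: D(3))
  qed
  then show "ad V (\<pi> a) = \<pi> (grading a)"
    by (simp add: \<open>V = U\<close> ad_def fun_eq_iff)
qed


section \<open>Hilbert tensor products\<close>

lemma hilbert_tensor_productD:
  assumes "hilbert_tensor_product t"
  shows "cbilinear t" "cinner (t x y) (t x' y') = cinner x x' * cinner y y'"
    "closure (cspan {t x y | x y. True}) = UNIV"
  using assms[unfolded hilbert_tensor_product_def, THEN conjunct1]
    assms[unfolded hilbert_tensor_product_def, THEN conjunct2, THEN conjunct1, rule_format]
    assms[unfolded hilbert_tensor_product_def, THEN conjunct2, THEN conjunct2] .

text \<open>The inner product formula gives the cross norm property, and hence the joint continuity
  of \<open>t\<close>.\<close>

lemma hilbert_tensor_product_bounded_bilinear: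
  assumes "hilbert_tensor_product t"
  shows "bounded_bilinear t"
proof -
  note D = hilbert_tensor_productD[OF assms]
  have "norm (t x y) = norm x * norm y" for x y
    by (simp add: norm_eq_sqrt_cinner D(2) norm_mult real_sqrt_mult)
  then show ?thesis
    by unfold_locales (simp_all add: cbilinearD[OF D(1)] scaleR_scaleC, rule exI[of _ 1], simp)
qed

lemma hilbert_tensor_product_eqI:
  assumes t: "hilbert_tensor_product t" and f: "bounded_clinear f" and g: "bounded_clinear g"
    and eq: "\<And>x y. f (t x y) = g (t x y)"
  shows "f = g"
proof
  fix z
  have lin: "clinear f" "clinear g" using f g by (auto simp: bounded_clinear_def)
  have "f z = g z" if "z \<in> cspan {t x y | x y. True}" for z
    using that
    by (induction rule: complex_vector.span_induct_alt)
      (auto simp: clinearD[OF lin(1)] clinearD[OF lin(2)] eq)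
  then show "f z = g z"
    by (rule continuous_eq_on_dense[OF bounded_clinear_continuous[OF f]
          bounded_clinear_continuous[OF g] hilbert_tensor_productD(3)[OF t]])
qed

text \<open>By joint continuity the closed range contains every \<open>t x y\<close>. Being the
  closure of a subspace, it then contains their span, which is dense.\<close>

lemma hilbert_tensor_product_dense:
  fixes t :: "'h::chilbert_space \<Rightarrow> 'k::chilbert_space \<Rightarrow> 'l::chilbert_space"
    and h :: "'i::complex_vector \<Rightarrow> 'l"
  assumes t: "hilbert_tensor_product t" and h: "clinear h"
    and X: "closure X = UNIV" and Y: "closure Y = UNIV"
    and XY: "\<And>x y. x \<in> X \<Longrightarrow> y \<in> Y \<Longrightarrow> t x y \<in> range h"
  shows "closure (range h) = UNIV"
proof -
  let ?C = "closure (range h)"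
  interpret bounded_bilinear t by (rule hilbert_tensor_product_bounded_bilinear[OF t])
  have "(\<lambda>p. t (fst p) (snd p)) ` closure (X \<times> Y) \<subseteq> ?C"
  proof (rule image_closure_subset)
    show "continuous_on (closure (X \<times> Y)) (\<lambda>p. t (fst p) (snd p))"
      by (rule continuous_on) (auto intro: continuous_intros)
    show "(\<lambda>p. t (fst p) (snd p)) ` (X \<times> Y) \<subseteq> ?C"
      using XY closure_subset[of "range h"] by fastforce
  qed simp
  from subsetD[OF this imageI, of "(x, y)" for x y] have tC: "t x y \<in> ?C" for x y
    by (simp add: closure_Times X Y)
  have "(\<lambda>p. c *\<^sub>C fst p + snd p) ` closure (range h \<times> range h) \<subseteq> ?C" for c
  proof (rule image_closure_subset)
    show "continuous_on (closure (range h \<times> range h)) (\<lambda>p. c *\<^sub>C fst p + snd p)"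
      by (rule continuous_on_add[OF continuous_on_compose2[OF
              bounded_clinear_continuous[OF bounded_clinear_scaleC, where S = UNIV]]])
        (auto intro: continuous_intros)
    show "(\<lambda>p. c *\<^sub>C fst p + snd p) ` (range h \<times> range h) \<subseteq> ?C"
    proof
      fix z assume "z \<in> (\<lambda>p. c *\<^sub>C fst p + snd p) ` (range h \<times> range h)"
      then obtain a b where "z = h (c *\<^sub>C a + b)"
        by (auto simp: clinearD(1,2)[OF h])
      then show "z \<in> ?C" using closure_subset[of "range h"] by blast
    qed
  qed simp
  from subsetD[OF this imageI, of "(x, y)" for x y]
  have comb: "c *\<^sub>C x + y \<in> ?C" if "x \<in> ?C" "y \<in> ?C" for c x y
    using that by (simp add: closure_Times)
  have "0 \<in> ?C"
    using closure_subset[of "range h"] clinearD(3)[OF h] by (metis rangeI subsetD)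
  have "z \<in> ?C" if "z \<in> cspan {t x y | x y. True}" for z
    using that
  proof (induction rule: complex_vector.span_induct_alt)
    case base
    show ?case by fact
  next
    case (step c x y)
    from step.hyps(1) obtain x1 x2 where "x = t x1 x2" by blast
    then show ?case using comb[OF tC] step by simp
  qed
  then have "closure (cspan {t x y | x y. True}) \<subseteq> ?C"
    by (intro closure_minimal subsetI closed_closure)
  then show ?thesis
    using hilbert_tensor_productD(3)[OF t] by blast
qed


section \<open>The Fermi tensor product\<close>

text \<open>Bilinearity of \<open>f\<close> is inherited from \<open>L\<close>, so it need not be
  established beforehand; this suits \<open>fermi_op\<close>, which is itself defined through a
  \<open>THE\<close>.\<close>

lemma tensor_lift_eqI:
  assumes "clinear L" "\<And>a b. f a b = L (a \<otimes>\<^sub>a b)"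
  shows "tensor_lift f = L"
proof -
  have "cbilinear f"
    by (rule cbilinearI) (simp_all add: assms(2) tensor_simps clinearD[OF assms(1)])
  then show ?thesis
    using ex1_tensor_lift assms tensor_lift_tensor clinear_tensor_lift by metis
qed

lemma even_state_odd:
  assumes "even_state \<omega>" "has_grade (- 1) a"
  shows "\<omega> a = 0"
proof -
  have "clinear \<omega>" and "\<omega> (grading a) = \<omega> a"
    using assms(1) by (auto simp: even_state_def state_def fun_eq_iff)
  then show ?thesis
    using assms(2) clinearD(2)[of \<omega> "- 1" a] by (simp add: has_grade_def scaleC_complex_def)
qed

text \<open>For odd \<open>a\<^sub>2\<close> the sign rule amounts to applying
  \<open>grading\<close> to \<open>b\<^sub>1\<close>. In this form it is linear in
  \<open>b\<^sub>1\<close> and covers inhomogeneous \<open>b\<^sub>1\<close>, hence all orbit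
  vectors.\<close>

lemma alg_tensor_mult_homogeneous:
  fixes a\<^sub>1 b\<^sub>1 :: "'a::z2_graded_star_algebra" and a\<^sub>2 b\<^sub>2 :: "'b::z2_graded_star_algebra"
  assumes a\<^sub>2: "has_grade u a\<^sub>2"
  shows "(a\<^sub>1 \<otimes>\<^sub>a a\<^sub>2) * (b\<^sub>1 \<otimes>\<^sub>a b\<^sub>2) = (a\<^sub>1 * (if u = - 1 then grading b\<^sub>1 else b\<^sub>1)) \<otimes>\<^sub>a (a\<^sub>2 * b\<^sub>2)"
proof -
  have hom: "(a\<^sub>1 \<otimes>\<^sub>a a\<^sub>2) * (b \<otimes>\<^sub>a b\<^sub>2) = (a\<^sub>1 * (if u = - 1 then grading b else b)) \<otimes>\<^sub>a (a\<^sub>2 * b\<^sub>2)"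
    if b: "homogeneous grading b" for b
  proof -
    obtain s where s: "has_grade s b" using homogeneous_has_grade[OF b] .
    then have "s = 1 \<or> s = - 1" "grading b = s *\<^sub>C b" by (auto simp: has_grade_def)
    then show ?thesis
      unfolding times_alg_tensor_def fermi_times_tensor[OF a\<^sub>2 s]
      using tensor_simps(3)[of "- 1" "a\<^sub>1 * b" "a\<^sub>2 * b\<^sub>2"]
      by (auto simp: grade_sign_def mult_scaleC_right tensor_simps scaleC_one)
  qed
  obtain b c where "b\<^sub>1 = b + c" "homogeneous grading b" "homogeneous grading c"
    by (rule homogeneous_decomp)
  then show ?thesis
    by (simp add: tensor_simps distrib_left grading_add hom)
qed

text \<open>Both sides are sesquilinear in \<open>x\<close> and \<open>y\<close>, so homogeneous
  elementary tensors suffice.\<close>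

lemma inner_product_functional:
  fixes \<omega>\<^sub>1 :: "'a::z2_graded_cstar_algebra \<Rightarrow> complex"
    and \<omega>\<^sub>2 :: "'b::z2_graded_cstar_algebra \<Rightarrow> complex"
    and t :: "'h::chilbert_space \<Rightarrow> 'k::chilbert_space \<Rightarrow> 'l::chilbert_space"
  assumes even: "even_state \<omega>\<^sub>1" "even_state \<omega>\<^sub>2"
    and gns: "gns_triple \<omega>\<^sub>1 \<pi>\<^sub>1 \<xi>\<^sub>1" "gns_triple \<omega>\<^sub>2 \<pi>\<^sub>2 \<xi>\<^sub>2"
    and t: "hilbert_tensor_product t"
    and h: "clinear h" "\<And>a b. h (a \<otimes>\<^sub>a b) = t (\<pi>\<^sub>1 a \<xi>\<^sub>1) (\<pi>\<^sub>2 b \<xi>\<^sub>2)"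
  shows "product_functional \<omega>\<^sub>1 \<omega>\<^sub>2 (star x * y) = cinner (h x) (h y)"
proof -
  have lin: "clinear \<omega>\<^sub>1" "clinear \<omega>\<^sub>2" using even by (auto simp: even_state_def state_def)
  note F = clinearD[OF product_functional_tensor(1)[OF lin]] product_functional_tensor(2)[OF lin]
  note simps = F clinearD[OF h(1)] star_add distrib_left distrib_right cinner_add_left cinner_add_right
  show ?thesis
  proof (induction x rule: alg_tensor_homogeneous_induct)
    case (tensor a\<^sub>1 a\<^sub>2)
    then obtain s u where a: "has_grade s a\<^sub>1" "has_grade u a\<^sub>2" by (metis homogeneous_has_grade)
    show ?case
    proof (induction y rule: alg_tensor_homogeneous_induct)
      case (tensor b\<^sub>1 b\<^sub>2)
      then obtain v where b: "has_grade v b\<^sub>1" by (metis homogeneous_has_grade)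
      \<comment> \<open>The factor \<open>z\<close> stands for the value of the second state. For
        equal grades the two signs coincide and square to 1; for different grades
        \<open>star a\<^sub>1 * b\<^sub>1\<close> is odd.\<close>
      have "grade_sign s u * (grade_sign u v * (\<omega>\<^sub>1 (star a\<^sub>1 * b\<^sub>1) * z)) = \<omega>\<^sub>1 (star a\<^sub>1 * b\<^sub>1) * z" for z
      proof (cases "s = v")
        case True
        then show ?thesis by (simp add: grade_sign_def)
      next
        case False
        then have "s * v = - 1"
          using has_gradeD[OF a(1)] has_gradeD[OF b] by auto
        then have "\<omega>\<^sub>1 (star a\<^sub>1 * b\<^sub>1) = 0"
          using even_state_odd[OF even(1)] has_grade_mult[OF has_grade_star[OF a(1)] b] by simp
        then show ?thesis by simp
      qed
      then show ?case
        by (simp add: star_alg_tensor_def times_alg_tensor_def fermi_star_tensor[OF a]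
            cbilinearD[OF fermi_times[THEN conjunct1]]
            fermi_times_tensor[OF has_grade_star[OF a(2)] b] F h(2) hilbert_tensor_productD(2)[OF t]
            gns_tripleD(5)[OF gns(1)] gns_tripleD(5)[OF gns(2)] scaleC_complex_def)
    qed (simp_all add: simps)
  qed (simp_all add: simps)
qed

text \<open>Any bounded operator with the right values is the one selected by \<open>THE\<close>:
  each vector of the first factor is a sum of two homogeneous ones, so those values fix the operator
  on all elementary tensors.\<close>

lemma fermi_op_homogeneous_eqI:
  fixes t :: "'h::chilbert_space \<Rightarrow> 'k::chilbert_space \<Rightarrow> 'l::chilbert_space"
  assumes t: "hilbert_tensor_product t" and T: "bounded_clinear T"
    and U: "clinear U\<^sub>1" "\<And>x. U\<^sub>1 (U\<^sub>1 x) = x"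
    and eq: "\<And>x y. homogeneous U\<^sub>1 x
      \<Longrightarrow> T (t x y) = koszul_sign (ad U\<^sub>2) U\<^sub>1 T\<^sub>2 x *\<^sub>C t (T\<^sub>1 x) (T\<^sub>2 y)"
  shows "fermi_op_homogeneous t U\<^sub>1 U\<^sub>2 T\<^sub>1 T\<^sub>2 = T"
  unfolding fermi_op_homogeneous_def
proof (rule the_equality)
  fix S assume S: "bounded_clinear S \<and> (\<forall>x y. homogeneous U\<^sub>1 x \<longrightarrow>
    S (t x y) = koszul_sign (ad U\<^sub>2) U\<^sub>1 T\<^sub>2 x *\<^sub>C t (T\<^sub>1 x) (T\<^sub>2 y))"
  then have lin: "clinear S" "clinear T" using T by (auto simp: bounded_clinear_def)
  show "S = T"
  proof (rule hilbert_tensor_product_eqI[OF t])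
    fix x y
    obtain x\<^sub>1 x\<^sub>2 where x: "x = x\<^sub>1 + x\<^sub>2" "U\<^sub>1 x\<^sub>1 = x\<^sub>1" "U\<^sub>1 x\<^sub>2 = - x\<^sub>2"
      using involution_decomp[OF U] .
    then have "S (t x\<^sub>1 y) = T (t x\<^sub>1 y)" "S (t x\<^sub>2 y) = T (t x\<^sub>2 y)"
      using S eq by (simp_all add: homogeneous_def)
    then show "S (t x y) = T (t x y)"
      by (simp add: x(1) cbilinearD[OF hilbert_tensor_productD(1)[OF t]]
          clinearD(1)[OF lin(1)] clinearD(1)[OF lin(2)])
  qed (simp_all only: S T)
qed (intro conjI allI impI T eq)

text \<open>By covariance, splitting the operator into even and odd parts is the same as splitting
  the algebra element.\<close>

lemma op_even_representation:
  assumes "clinear (\<lambda>a. \<rho> a x)" "ad V (\<rho> a) = \<rho> (grading a)"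
  shows "op_even V (\<rho> a) x = \<rho> ((1/2::complex) *\<^sub>C (a + grading a)) x"
    and "op_odd V (\<rho> a) x = \<rho> ((1/2::complex) *\<^sub>C (a - grading a)) x"
  by (simp_all only: op_even_def op_odd_def assms(2) clinearD[OF assms(1)])

theorem proposition3p4:
  fixes \<omega>\<^sub>1 :: "'a::z2_graded_cstar_algebra \<Rightarrow> complex"
    and \<omega>\<^sub>2 :: "'b::z2_graded_cstar_algebra \<Rightarrow> complex"
    and \<pi>\<^sub>1 :: "'a \<Rightarrow> 'h::chilbert_space \<Rightarrow> 'h" and \<xi>\<^sub>1 :: 'h
    and \<pi>\<^sub>2 :: "'b \<Rightarrow> 'k::chilbert_space \<Rightarrow> 'k" and \<xi>\<^sub>2 :: 'k
    and \<pi> :: "('a, 'b) alg_tensor \<Rightarrow> 'g::chilbert_space \<Rightarrow> 'g" and \<xi> :: 'g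
    and t :: "'h \<Rightarrow> 'k \<Rightarrow> 'l::chilbert_space"
  assumes "even_state \<omega>\<^sub>1" and "even_state \<omega>\<^sub>2"
    and "gns_triple \<omega>\<^sub>1 \<pi>\<^sub>1 \<xi>\<^sub>1" and "gns_triple \<omega>\<^sub>2 \<pi>\<^sub>2 \<xi>\<^sub>2"
    and "gns_triple (product_functional \<omega>\<^sub>1 \<omega>\<^sub>2) \<pi> \<xi>"
    and "hilbert_tensor_product t"
  shows "unitarily_equivalent \<pi>
    (fermi_representation t (gns_grading \<pi>\<^sub>1 \<xi>\<^sub>1) (gns_grading \<pi>\<^sub>2 \<xi>\<^sub>2) \<pi>\<^sub>1 \<pi>\<^sub>2)"
proof -
  note even = assms(1,2) and gns\<^sub>1 = assms(3) and gns\<^sub>2 = assms(4) and gns = assms(5)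
    and t = assms(6)
  note D\<^sub>1 = gns_tripleD[OF gns\<^sub>1] and D\<^sub>2 = gns_tripleD[OF gns\<^sub>2] and D = gns_tripleD[OF gns]
  define V\<^sub>1 where "V\<^sub>1 = gns_grading \<pi>\<^sub>1 \<xi>\<^sub>1"
  define V\<^sub>2 where "V\<^sub>2 = gns_grading \<pi>\<^sub>2 \<xi>\<^sub>2"
  note V\<^sub>1 = gns_grading_properties[OF even(1) gns\<^sub>1, folded V\<^sub>1_def]
    and V\<^sub>2 = gns_grading_properties[OF even(2) gns\<^sub>2, folded V\<^sub>2_def]
  have lin: "clinear (\<lambda>a. \<pi>\<^sub>1 a x)" "clinear (\<lambda>b. \<pi>\<^sub>2 b y)" "clinear (\<lambda>c. \<pi> c z)" for x y z
    by (rule D\<^sub>1(2) D\<^sub>2(2) D(2))+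
  have linV\<^sub>1: "clinear V\<^sub>1" using V\<^sub>1(1) by (simp add: unitary_def)
  have op_lin: "clinear (\<pi>\<^sub>1 a)" for a using D\<^sub>1(1) by (simp add: bounded_clinear_def)
  note t_simps = cbilinearD[OF hilbert_tensor_productD(1)[OF t]]
  interpret t: bounded_bilinear t by (rule hilbert_tensor_product_bounded_bilinear[OF t])

  \<comment> \<open>The intertwining unitary\<close>
  define h where "h = tensor_lift (\<lambda>a b. t (\<pi>\<^sub>1 a \<xi>\<^sub>1) (\<pi>\<^sub>2 b \<xi>\<^sub>2))"
  have bi: "cbilinear (\<lambda>a b. t (\<pi>\<^sub>1 a \<xi>\<^sub>1) (\<pi>\<^sub>2 b \<xi>\<^sub>2))"
    by (rule cbilinearI)
      (simp_all add: t_simps clinearD[OF lin(1)] clinearD[OF lin(2)])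
  have h: "clinear h" "h (a \<otimes>\<^sub>a b) = t (\<pi>\<^sub>1 a \<xi>\<^sub>1) (\<pi>\<^sub>2 b \<xi>\<^sub>2)" for a b
    unfolding h_def by (rule clinear_tensor_lift[OF bi], rule tensor_lift_tensor[OF bi])
  have iso: "norm (h x) = norm (\<pi> x \<xi>)" for x
    by (intro norm_eqI_cinner) (simp add: D(5) inner_product_functional[OF even gns\<^sub>1 gns\<^sub>2 t h])
  have dense: "closure (range h) = UNIV"
    by (rule hilbert_tensor_product_dense[OF t h(1) D\<^sub>1(4) D\<^sub>2(4)]) (auto simp flip: h(2))
  obtain W where W: "unitary W" "\<And>x. W (\<pi> x \<xi>) = h x"
    using unitary_extension[OF D(2) h(1) iso D(4) dense] by blast
  note W' = unitary_inv[OF W(1)]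

  \<comment> \<open>The representation transported to the tensor product space\<close>
  define S where "S c z = W (\<pi> c (inv W z))" for c z
  \<comment> \<open>Boundedness comes from that of \<open>\<pi> c\<close>; it makes \<open>S\<close>
    a witness for the \<open>THE\<close> in \<open>fermi_op_homogeneous\<close> without any norm
    estimate.\<close>
  have bS: "bounded_clinear (S c)" for c
    unfolding S_def
    by (rule bounded_clinear_compose[OF unitary_bounded_clinear[OF W(1)]
          bounded_clinear_compose[OF D(1) W'(1)]])
  have linS: "clinear (\<lambda>c. S c z)" for z
    using W(1) lin(3) by (auto simp: S_def clinear_def unitary_def)

  \<comment> \<open>Writing the sign as an application of \<open>V\<^sub>1\<close> makes the formula
    meaningful for every \<open>x\<close>. Both sides are continuous in the pair, so orbit vectors
    suffice.\<close>
  have S_tensor: "S (a\<^sub>1 \<otimes>\<^sub>a a\<^sub>2) (t x y) = t (\<pi>\<^sub>1 a\<^sub>1 (if u = - 1 then V\<^sub>1 x else x)) (\<pi>\<^sub>2 a\<^sub>2 y)"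
    if u: "has_grade u a\<^sub>2" for u a\<^sub>1 a\<^sub>2 x y
  proof -
    let ?X = "range (\<lambda>a. \<pi>\<^sub>1 a \<xi>\<^sub>1) \<times> range (\<lambda>b. \<pi>\<^sub>2 b \<xi>\<^sub>2)"
    let ?v = "\<lambda>x. \<pi>\<^sub>1 a\<^sub>1 (if u = - 1 then V\<^sub>1 x else x)"
    have bv: "bounded_clinear ?v"
      using bounded_clinear_compose[OF D\<^sub>1(1) unitary_bounded_clinear[OF V\<^sub>1(1)]] D\<^sub>1(1)
      by (cases "u = - 1") simp_all
    have "S (a\<^sub>1 \<otimes>\<^sub>a a\<^sub>2) (t (fst p) (snd p)) = t (?v (fst p)) (\<pi>\<^sub>2 a\<^sub>2 (snd p))" for p
    proof (rule continuous_eq_on_dense[of "\<lambda>p. S (a\<^sub>1 \<otimes>\<^sub>a a\<^sub>2) (t (fst p) (snd p))"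
          "\<lambda>p. t (?v (fst p)) (\<pi>\<^sub>2 a\<^sub>2 (snd p))" ?X])
      show "continuous_on UNIV (\<lambda>p. S (a\<^sub>1 \<otimes>\<^sub>a a\<^sub>2) (t (fst p) (snd p)))"
        by (rule continuous_on_compose2[OF bounded_clinear_continuous[OF bS]
              t.continuous_on[OF continuous_on_fst continuous_on_snd]])
          (rule continuous_on_id subset_UNIV)+
      show "continuous_on UNIV (\<lambda>p. t (?v (fst p)) (\<pi>\<^sub>2 a\<^sub>2 (snd p)))"
        by (rule t.continuous_on[OF
              continuous_on_compose2[OF bounded_clinear_continuous[OF bv] continuous_on_fst]
              continuous_on_compose2[OF bounded_clinear_continuous[OF D\<^sub>2(1)] continuous_on_snd]])
          (rule continuous_on_id subset_UNIV)+
      show "closure ?X = UNIV"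
        by (simp add: closure_Times D\<^sub>1(4) D\<^sub>2(4))
      fix p assume "p \<in> ?X"
      then obtain b\<^sub>1 b\<^sub>2 where p: "p = (\<pi>\<^sub>1 b\<^sub>1 \<xi>\<^sub>1, \<pi>\<^sub>2 b\<^sub>2 \<xi>\<^sub>2)" by auto
      \<comment> \<open>Since \<open>W\<close> carries \<open>\<pi> c \<xi>\<close> to
        \<open>h c\<close>, the operators \<open>S\<close> act on the values of \<open>h\<close> by
        left multiplication.\<close>
      have "S (a\<^sub>1 \<otimes>\<^sub>a a\<^sub>2) (h (b\<^sub>1 \<otimes>\<^sub>a b\<^sub>2)) = h ((a\<^sub>1 \<otimes>\<^sub>a a\<^sub>2) * (b\<^sub>1 \<otimes>\<^sub>a b\<^sub>2))"
        unfolding S_def W(2)[symmetric] W'(2) D(3) ..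
      also have "\<dots> = t (\<pi>\<^sub>1 a\<^sub>1 (\<pi>\<^sub>1 (if u = - 1 then grading b\<^sub>1 else b\<^sub>1) \<xi>\<^sub>1)) (\<pi>\<^sub>2 a\<^sub>2 (\<pi>\<^sub>2 b\<^sub>2 \<xi>\<^sub>2))"
        unfolding alg_tensor_mult_homogeneous[OF u] h(2) D\<^sub>1(3) D\<^sub>2(3) ..
      finally show "S (a\<^sub>1 \<otimes>\<^sub>a a\<^sub>2) (t (fst p) (snd p)) = t (?v (fst p)) (\<pi>\<^sub>2 a\<^sub>2 (snd p))"
        by (simp add: p h(2) V\<^sub>1(2))
    qed
    from this[of "(x, y)"] show ?thesis by simp
  qed

  \<comment> \<open>Fermi tensor products of the represented operators\<close>
  have hom: "fermi_op_homogeneous t V\<^sub>1 V\<^sub>2 (\<pi>\<^sub>1 a\<^sub>1) (\<pi>\<^sub>2 a\<^sub>2) = S (a\<^sub>1 \<otimes>\<^sub>a a\<^sub>2)"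
    if u: "has_grade u a\<^sub>2" for u a\<^sub>1 a\<^sub>2
  proof (rule fermi_op_homogeneous_eqI[OF t bS linV\<^sub>1 V\<^sub>1(3)])
    fix x y assume x: "homogeneous V\<^sub>1 x"
    have ad: "ad V\<^sub>2 (\<pi>\<^sub>2 a\<^sub>2) z = u *\<^sub>C \<pi>\<^sub>2 a\<^sub>2 z" for z
      using u clinearD(2)[OF lin(2)] by (simp add: V\<^sub>2(4) has_grade_def)
    have "koszul_sign (ad V\<^sub>2) V\<^sub>1 (\<pi>\<^sub>2 a\<^sub>2) x *\<^sub>C t (\<pi>\<^sub>1 a\<^sub>1 x) (\<pi>\<^sub>2 a\<^sub>2 y)
      = t (\<pi>\<^sub>1 a\<^sub>1 (if u = - 1 then V\<^sub>1 x else x)) (\<pi>\<^sub>2 a\<^sub>2 y)"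
    proof (cases "u = 1")
      case True
      \<comment> \<open>\<open>koszul_sign\<close> tests the parity of the operator, not the grade
        \<open>u\<close> of \<open>a\<^sub>2\<close>. If \<open>u = 1\<close> and the operator is
        nevertheless odd, it is zero and the sign is irrelevant.\<close>
      then have "\<pi>\<^sub>2 a\<^sub>2 y = 0" if "ad V\<^sub>2 (\<pi>\<^sub>2 a\<^sub>2) = - \<pi>\<^sub>2 a\<^sub>2"
        using ad[of y] that by (intro eq_uminus_imp_zero) (simp add: scaleC_one)
      then show ?thesis
        using True by (auto simp: koszul_sign_def scaleC_one t_simps)
    next
      case False
      then have u: "u = - 1" using has_gradeD[OF u] by blast
      then have "ad V\<^sub>2 (\<pi>\<^sub>2 a\<^sub>2) = - \<pi>\<^sub>2 a\<^sub>2"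
        by (simp add: fun_eq_iff ad complex_vector.scale_minus_left scaleC_one)
      \<comment> \<open>The same ambiguity on the vector side: only 0 is both even and odd.\<close>
      moreover have "x = 0" if "V\<^sub>1 x = x" "V\<^sub>1 x = - x"
        using that by (intro eq_uminus_imp_zero) simp
      moreover have "\<pi>\<^sub>1 a\<^sub>1 (- x) = - \<pi>\<^sub>1 a\<^sub>1 x"
        using clinearD(2)[OF op_lin, of a\<^sub>1 "- 1" x]
        by (simp add: complex_vector.scale_minus_left scaleC_one)
      ultimately show ?thesis
        using x u by (auto simp: homogeneous_def koszul_sign_def scaleC_one t_simps t.minus_left
            clinearD(3)[OF op_lin])
    qed
    then show "S (a\<^sub>1 \<otimes>\<^sub>a a\<^sub>2) (t x y)
      = koszul_sign (ad V\<^sub>2) V\<^sub>1 (\<pi>\<^sub>2 a\<^sub>2) x *\<^sub>C t (\<pi>\<^sub>1 a\<^sub>1 x) (\<pi>\<^sub>2 a\<^sub>2 y)"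
      by (simp add: S_tensor[OF u])
  qed

  have op: "fermi_op t V\<^sub>1 V\<^sub>2 (\<pi>\<^sub>1 a\<^sub>1) (\<pi>\<^sub>2 a\<^sub>2) z = S (a\<^sub>1 \<otimes>\<^sub>a a\<^sub>2) z" for a\<^sub>1 a\<^sub>2 z
  proof -
    \<comment> \<open>These are the even and odd parts of \<open>a\<^sub>2\<close>;
      \<open>hom\<close> applies to each, and they add up to \<open>a\<^sub>2\<close>.\<close>
    let ?e = "(1/2::complex) *\<^sub>C (a\<^sub>2 + grading a\<^sub>2)" and ?o = "(1/2::complex) *\<^sub>C (a\<^sub>2 - grading a\<^sub>2)"
    have "has_grade 1 ?e"
      by (simp add: has_grade_def grading_scaleC grading_add grading_grading add.commute scaleC_one)
    moreover have "has_grade (- 1) ?o"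
      by (simp add: has_grade_def grading_scaleC grading_diff grading_grading scaleC_scaleC
          scaleC_one complex_vector.scale_right_diff_distrib)
    moreover have "op_even V\<^sub>2 (\<pi>\<^sub>2 a\<^sub>2) = \<pi>\<^sub>2 ?e" "op_odd V\<^sub>2 (\<pi>\<^sub>2 a\<^sub>2) = \<pi>\<^sub>2 ?o"
      using op_even_representation[where \<rho> = \<pi>\<^sub>2, OF lin(2) V\<^sub>2(4)] by (simp_all add: fun_eq_iff)
    ultimately have "fermi_op t V\<^sub>1 V\<^sub>2 (\<pi>\<^sub>1 a\<^sub>1) (\<pi>\<^sub>2 a\<^sub>2) z = S (a\<^sub>1 \<otimes>\<^sub>a ?e) z + S (a\<^sub>1 \<otimes>\<^sub>a ?o) z"
      by (simp add: fermi_op_def hom)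
    also have "\<dots> = S (a\<^sub>1 \<otimes>\<^sub>a (?e + ?o)) z"
      by (simp only: tensor_simps(2) clinearD(1)[OF linS])
    also have "?e + ?o = (1/2::complex) *\<^sub>C a\<^sub>2 + (1/2) *\<^sub>C a\<^sub>2"
      by (simp add: scaleC_add_right complex_vector.scale_right_diff_distrib)
    finally show ?thesis by (simp add: half_sum)
  qed
  \<comment> \<open>For fixed \<open>z\<close> the map \<open>\<lambda>c. S c z\<close> is linear
    and agrees with \<open>fermi_op\<close> on elementary tensors, so it is the lift. Intertwining
    by \<open>W\<close> is then the definition of \<open>S\<close>.\<close>
  have "fermi_representation t V\<^sub>1 V\<^sub>2 \<pi>\<^sub>1 \<pi>\<^sub>2 c z = S c z" for c z
    unfolding fermi_representation_def by (subst tensor_lift_eqI[OF linS op]) simp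
  then have "W \<circ> \<pi> c = fermi_representation t V\<^sub>1 V\<^sub>2 \<pi>\<^sub>1 \<pi>\<^sub>2 c \<circ> W" for c
    by (simp add: fun_eq_iff S_def W'(2))
  then show ?thesis
    using W(1) unfolding unitarily_equivalent_def V\<^sub>1_def V\<^sub>2_def by blast
qed

end
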